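(* The action $\mathbb{Z}^2 \rtimes \mathrm{SL}_2(\mathbb{Z}) \curvearrowright \mathbb{R}^2$ is projectively rigid.
   Context: $\mathbb{Z}^2 \rtimes \mathrm{SL}_2(\mathbb{Z})$ denotes the group, under composition, of all functions $T \colon \mathbb{R}^2 \to \mathbb{R}^2$ of the form $T(x) = Ax + b$, where $A \in \mathrm{SL}_2(\mathbb{Z})$ and $b \in \mathbb{Z}^2$, with its evident action on $\mathbb{R}^2$. An equivalence relation is countable (finite) if all of its classes are countable (finite). For a set $B$, $E \upharpoonright B = E \cap (B \times B)$. A Borel equivalence relation on a standard Borel space is hyperfinite if it is the union of an increasing sequence $(E_n)_{n \in \mathbb{N}}$ of finite Borel equivalence relations on that space. A function is countable-to-one if preimages of points are countable. Given a relation $R \subseteq X \times X$, an action $\Delta \curvearrowright Y$, and a function $\rho \colon R \to \Delta$, a function $\phi \colon X \to Y$ is $\rho$-invariant if $x_1 \mathrel{R} x_2 \implies \phi(x_1) = \rho(x_1, x_2) \cdot \phi(x_2)$ for all $x_1, x_2 \in X$. The difference set of functions $\phi \colon A \to Y$ and $\psi \colon B \to Y$, with $A, B \subseteq X$, is $D(\phi, \psi) = \{x \in A \cap B \mid \phi(x) \neq \psi(x)\} \cup (A \mathbin{\triangle} B)$. A Borel action $\Delta \curvearrowright Y$ of a countable discrete group on a standard Borel space is projectively rigid if whenever $X$ is a standard Borel space, $E$ is a countable Borel equivalence relation on $X$, $\rho \colon E \to \Delta$ is a Borel function, and $\phi, \psi \colon X \to Y$ are countable-to-one $\rho$-invariant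 Borel functions, the relation $E \upharpoonright D(\phi, \psi)$ is hyperfinite. *)

theory Defs
  imports "HOL-Analysis.Analysis" "HOL-Algebra.Group_Action"
begin

text \<open>Measures are used only as carriers of a \<open>\<sigma>\<close>-algebra; their values play no role.\<close>

definition standard_borel :: "'a measure \<Rightarrow> bool" where
  "standard_borel M \<longleftrightarrow>
     (\<exists>T. completely_metrizable_space T \<and> second_countable T \<and> topspace T = space M \<and>
          sets M = sigma_sets (space M) {U. openin T U})"

definition borel_equiv_rel :: "'a measure \<Rightarrow> ('a \<times> 'a) set \<Rightarrow> bool" where
  "borel_equiv_rel M E \<longleftrightarrow> equiv (space M) E \<and> E \<in> sets (M \<Otimes>\<^sub>M M)"

definition countable_rel :: "'a measure \<Rightarrow> ('a \<times> 'a) set \<Rightarrow> bool" where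
  "countable_rel M E \<longleftrightarrow> (\<forall>C \<in> space M // E. countable C)"

definition finite_rel :: "'a measure \<Rightarrow> ('a \<times> 'a) set \<Rightarrow> bool" where
  "finite_rel M E \<longleftrightarrow> (\<forall>C \<in> space M // E. finite C)"

text \<open>Meant for standard Borel \<open>M\<close>; standardness is left to the context in which it is used.\<close>

definition hyperfinite :: "'a measure \<Rightarrow> ('a \<times> 'a) set \<Rightarrow> bool" where
  "hyperfinite M E \<longleftrightarrow> borel_equiv_rel M E \<and>
     (\<exists>F :: nat \<Rightarrow> ('a \<times> 'a) set.
        (\<forall>n. borel_equiv_rel M (F n) \<and> finite_rel M (F n)) \<and> incseq F \<and> E = (\<Union>n. F n))"

definition rel_restrict :: "('a \<times> 'a) set \<Rightarrow> 'a set \<Rightarrow> ('a \<times> 'a) set" where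
  "rel_restrict E B = E \<inter> (B \<times> B)"

definition countable_to_one_on :: "'a set \<Rightarrow> 'b set \<Rightarrow> ('a \<Rightarrow> 'b) \<Rightarrow> bool" where
  "countable_to_one_on A B f \<longleftrightarrow> (\<forall>y\<in>B. countable {x \<in> A. f x = y})"

definition rho_invariant ::
  "'x set \<Rightarrow> ('x \<times> 'x) set \<Rightarrow> ('g \<Rightarrow> 'y \<Rightarrow> 'y) \<Rightarrow> ('x \<times> 'x \<Rightarrow> 'g) \<Rightarrow> ('x \<Rightarrow> 'y) \<Rightarrow> bool" where
  "rho_invariant X R act \<rho> \<phi> \<longleftrightarrow>
     (\<forall>x1\<in>X. \<forall>x2\<in>X. (x1, x2) \<in> R \<longrightarrow> \<phi> x1 = act (\<rho> (x1, x2)) (\<phi> x2))"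

text \<open>The sets \<open>A\<close> and \<open>B\<close> are the domains of \<open>\<phi>\<close> and \<open>\<psi>\<close>.\<close>

definition difference_set :: "'x set \<Rightarrow> ('x \<Rightarrow> 'y) \<Rightarrow> 'x set \<Rightarrow> ('x \<Rightarrow> 'y) \<Rightarrow> 'x set" where
  "difference_set A \<phi> B \<psi> = {x \<in> A \<inter> B. \<phi> x \<noteq> \<psi> x} \<union> ((A - B) \<union> (B - A))"

definition borel_action :: "('g, 'm) monoid_scheme \<Rightarrow> 'y measure \<Rightarrow> ('g \<Rightarrow> 'y \<Rightarrow> 'y) \<Rightarrow> bool" where
  "borel_action G Y act \<longleftrightarrow>
     countable (carrier G) \<and> standard_borel Y \<and> group_action G (space Y) act \<and>
     (\<lambda>(g, y). act g y) \<in> measurable (count_space (carrier G) \<Otimes>\<^sub>M Y) Y"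

text \<open>
  A definition cannot quantify over types, so the type \<open>'x\<close> carrying the standard Borel
  spaces \<open>X\<close> is a parameter; a theorem with free \<open>'x\<close> covers all of them.
\<close>

definition projectively_rigid ::
  "'x itself \<Rightarrow> ('g, 'm) monoid_scheme \<Rightarrow> 'y measure \<Rightarrow> ('g \<Rightarrow> 'y \<Rightarrow> 'y) \<Rightarrow> bool" where
  "projectively_rigid (_ :: 'x itself) G Y act \<longleftrightarrow>
     borel_action G Y act \<and>
     (\<forall>(X :: 'x measure) E \<rho> \<phi> \<psi>.
        standard_borel X \<longrightarrow>
        borel_equiv_rel X E \<longrightarrow> countable_rel X E \<longrightarrow>
        \<rho> \<in> measurable (restrict_space (X \<Otimes>\<^sub>M X) E) (count_space (carrier G)) \<longrightarrow>
        \<phi> \<in> measurable X Y \<longrightarrow> countable_to_one_on (space X) (space Y) \<phi> \<longrightarrow>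
        rho_invariant (space X) E act \<rho> \<phi> \<longrightarrow>
        \<psi> \<in> measurable X Y \<longrightarrow> countable_to_one_on (space X) (space Y) \<psi> \<longrightarrow>
        rho_invariant (space X) E act \<rho> \<psi> \<longrightarrow>
        hyperfinite (restrict_space X (difference_set (space X) \<phi> (space X) \<psi>))
          (rel_restrict E (difference_set (space X) \<phi> (space X) \<psi>)))"

definition int_affine_map :: "int^2^2 \<Rightarrow> int^2 \<Rightarrow> real^2 \<Rightarrow> real^2" where
  "int_affine_map A b x = (\<chi> i j. real_of_int (A $ i $ j)) *v x + (\<chi> i. real_of_int (b $ i))"

definition Z2_SL2Z :: "(real^2 \<Rightarrow> real^2) monoid" where
  "Z2_SL2Z = \<lparr>carrier = {int_affine_map A b |A b. det A = 1}, mult = (\<circ>), one = id\<rparr>"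

end

theory Submission
  imports Defs
begin

text \<open>
  Let \<open>\<Gamma>\<close> act diagonally on pairs \<open>(u, w)\<close> with \<open>u \<noteq> w\<close>; the invariance of \<open>\<phi>\<close> and \<open>\<psi>\<close> says that
  \<open>x \<mapsto> (\<phi> x, \<psi> x)\<close> maps related points of the difference set into one \<open>\<Gamma>\<close>-orbit.  The vector \<open>u - w\<close>
  transforms linearly, and it allows a Borel choice of points \<open>\<rho> n (u, w)\<close> in the orbit of \<open>(u, w)\<close>
  that is asymptotically invariant: any two pairs in one orbit have the same \<open>\<rho> n\<close> for all large \<open>n\<close>.
  If \<open>u - w\<close> has irrational slope, \<open>\<rho> n\<close> comes from a basis of \<open>\<int>\<^sup>2\<close> on which \<open>u - w\<close> takes values below
  \<open>1 / (n + 1)\<close> and which is as small as possible.  If it has rational slope, it can be made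
  horizontal, its stabiliser acts on the remaining coordinate of \<open>u\<close> by a rotation of the circle, and
  \<open>\<rho> n\<close> is the first visit of the rotation to a shrinking interval.

  Two points are identified at stage \<open>n\<close> if the \<open>\<rho> k\<close> merge before \<open>n\<close> and if all steps of the way are
  coded by numbers at most \<open>n\<close>.  For the classes to be finite one also has to bound a label that
  separates the points of each fibre of \<open>\<phi>\<close>; it is given by the Lusin--Novikov theorem, which is proved
  from the separation theorem for analytic sets: if the space is not a countable union of Borel sets on
  which \<open>\<phi>\<close> is injective, a Cantor scheme produces an uncountable fibre.
\<close>

section \<open>Analytic sets\<close>

text \<open>No exactly invariant choice is made, because the size of an integral matrix depends on
  the point of the orbit from which it is seen. The remedy is to ask that the second row take a
  value in \<open>(0, \<epsilon>)\<close> on \<open>u - w\<close>: such rows are long and nearly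
  parallel, so passing to another point of the orbit multiplies their first entries by almost the
  same factor, and the minimisers agree once \<epsilon> is small. In the rational case two points of
  an orbit disagree only about a bounded stretch of the count, and a small enough interval is not
  visited during it.

  Only the chosen state has to be unique, not the map that leads to it, so stabilisers do no harm.
  Integral affine maps are coded by integer tuples, a countable type; every choice is the least code
  with a Borel property and hence Borel.

  Merging alone does not give finite classes, since infinitely many points may share
  \<open>\<rho> n\<close>. Recording how \<open>\<rho> k\<close> is recovered from
  \<open>\<rho> (k + 1)\<close> makes the passage back finite-to-one as long as the records are
  bounded.\<close>

definition agree_upto :: "(nat \<Rightarrow> 'a) \<Rightarrow> nat \<Rightarrow> (nat \<Rightarrow> 'a) set" where
  "agree_upto z n = {w. \<forall>i<n. w i = z i}"

lemma agree_upto_refl [simp]: "z \<in> agree_upto z n"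
  by (simp add: agree_upto_def)

lemma agree_upto_0 [simp]: "agree_upto z 0 = UNIV"
  by (simp add: agree_upto_def)

lemma agree_upto_Suc: "agree_upto z n = (\<Union>a. agree_upto (z(n := a)) (Suc n))"
proof -
  have "w \<in> agree_upto (z(n := w n)) (Suc n)" if "w \<in> agree_upto z n" for w
    using that by (auto simp: agree_upto_def)
  moreover have "agree_upto (z(n := a)) (Suc n) \<subseteq> agree_upto z n" for a
    by (auto simp: agree_upto_def)
  ultimately show ?thesis
    by blast
qed

lemma agree_upto_mono: "m \<le> n \<Longrightarrow> agree_upto z n \<subseteq> agree_upto z m"
  by (auto simp: agree_upto_def)

lemma agree_upto_cong: "(\<And>i. i < n \<Longrightarrow> z i = w i) \<Longrightarrow> agree_upto z n = agree_upto w n"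
  by (auto simp: agree_upto_def)

lemma open_agree_upto [simp]: "open (agree_upto (z :: nat \<Rightarrow> nat) n)"
proof -
  have "open {w. \<forall>i\<in>{..<n}. w (id i) \<in> {z i}}"
    by (rule product_topology_basis') (auto simp: open_discrete)
  then show ?thesis
    by (simp add: agree_upto_def Ball_def)
qed

lemma open_nat_fun_iff:
  "open (U :: (nat \<Rightarrow> nat) set) \<longleftrightarrow> (\<forall>z\<in>U. \<exists>n. agree_upto z n \<subseteq> U)"
proof
  assume U: "open U"
  show "\<forall>z\<in>U. \<exists>n. agree_upto z n \<subseteq> U"
  proof
    fix z assume "z \<in> U"
    moreover have "openin (product_topology (\<lambda>i. euclidean) UNIV) U"
      using U by (simp add: open_fun_def)
    ultimately obtain V where V: "finite {i. V i \<noteq> UNIV}" "z \<in> Pi\<^sub>E UNIV V" "Pi\<^sub>E UNIV V \<subseteq> U"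
      unfolding openin_product_topology_alt by auto
    obtain n where n: "\<And>i. V i \<noteq> UNIV \<Longrightarrow> i < n"
      using V(1) finite_nat_set_iff_bounded by auto
    have "w \<in> Pi\<^sub>E UNIV V" if "w \<in> agree_upto z n" for w
    proof -
      have "w i \<in> V i" for i
        using that V(2) n [of i] by (cases "i < n") (auto simp: agree_upto_def PiE_def Pi_def)
      then show ?thesis by auto
    qed
    then show "\<exists>n. agree_upto z n \<subseteq> U"
      using V(3) by blast
  qed
next
  assume *: "\<forall>z\<in>U. \<exists>n. agree_upto z n \<subseteq> U"
  show "open U"
    by (subst open_subopen) (metis "*" open_agree_upto agree_upto_refl)
qed

lemma second_countable_euclidean:
  "second_countable (euclidean :: 'a::second_countable_topology topology)"
proof -
  obtain B :: "'a set set" where "countable B" "topological_basis B"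
    using ex_countable_basis by blast
  moreover have "\<exists>V\<in>B. x \<in> V \<and> V \<subseteq> U" if "open U" "x \<in> U" for U x
    using topological_basisE [OF \<open>topological_basis B\<close> that] by metis
  ultimately show ?thesis
    unfolding second_countable_def
    by (intro exI [of _ B]) (simp add: topological_basis_open)
qed

lemma continuous_map_euclidean_iff:
  "continuous_map euclidean T h \<longleftrightarrow>
     range h \<subseteq> topspace T \<and> (\<forall>U. openin T U \<longrightarrow> open (h -` U))"
proof -
  have "{x. h x \<in> U} = h -` U" for U
    by auto
  then show ?thesis
    unfolding continuous_map_def by (auto simp: Pi_iff)
qed

lemma continuous_map_nat_cases:
  assumes c: "continuous_on UNIV (c :: 'z::topological_space \<Rightarrow> nat)"
    and g: "\<And>n. continuous_map euclidean T (g n)"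
  shows "continuous_map euclidean T (\<lambda>z. g (c z) z)"
  unfolding continuous_map_euclidean_iff
proof (intro conjI allI impI)
  show "range (\<lambda>z. g (c z) z) \<subseteq> topspace T"
    using g unfolding continuous_map_euclidean_iff by blast
  fix U assume U: "openin T U"
  have "(\<lambda>z. g (c z) z) -` U = (\<Union>n. (c -` {n}) \<inter> g n -` U)"
    by blast
  moreover have "open (c -` {n})" for n
    using c by (intro open_vimage open_discrete)
  moreover have "open (g n -` U)" for n
    using g U unfolding continuous_map_euclidean_iff by blast
  ultimately show "open ((\<lambda>z. g (c z) z) -` U)"
    by (metis (no_types, lifting) open_Int open_UN)
qed

section \<open>Continuous images of the Baire space\<close>

definition analytic_in :: "'a topology \<Rightarrow> 'a set \<Rightarrow> bool" where
  "analytic_in T A \<longleftrightarrow>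
     A = {} \<or> (\<exists>p :: (nat \<Rightarrow> nat) \<Rightarrow> 'a. continuous_map euclidean T p \<and> range p = A)"

lemma analytic_inE:
  assumes "analytic_in T A" "A \<noteq> {}"
  obtains p :: "(nat \<Rightarrow> nat) \<Rightarrow> 'a" where "continuous_map euclidean T p" "range p = A"
  using assms by (auto simp: analytic_in_def)

lemma analytic_in_empty [simp]: "analytic_in T {}"
  by (simp add: analytic_in_def)

lemma analytic_in_subset: "analytic_in T A \<Longrightarrow> A \<subseteq> topspace T"
  by (auto simp: analytic_in_def continuous_map_def)

lemma analytic_in_image:
  assumes "analytic_in T A" "continuous_map T T' h"
  shows "analytic_in T' (h ` A)"
proof (cases "A = {}")
  case False
  then obtain p :: "(nat \<Rightarrow> nat) \<Rightarrow> 'a" where p: "continuous_map euclidean T p" "range p = A"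
    using analytic_inE [OF assms(1)] by blast
  have "continuous_map euclidean T' (h \<circ> p)" "range (h \<circ> p) = h ` A"
    using continuous_map_compose [OF p(1) assms(2)] p(2) by auto
  then show ?thesis
    unfolding analytic_in_def by blast
qed simp

lemma analytic_in_UN:
  assumes "\<And>n::nat. analytic_in T (A n)"
  shows "analytic_in T (\<Union>n. A n)"
proof (cases "\<exists>n. A n \<noteq> {}")
  case True
  then obtain n0 where n0: "A n0 \<noteq> {}" by blast
  \<comment> \<open>Empty members borrow a nonempty one, so that every index has a parametrisation;
    the first entry of \<open>z\<close> in \<open>q\<close> then selects the index.\<close>
  define B where "B n = (if A n = {} then A n0 else A n)" for n
  have "\<exists>p :: (nat \<Rightarrow> nat) \<Rightarrow> 'a. continuous_map euclidean T p \<and> range p = B n" for n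
  proof -
    have "analytic_in T (B n)" "B n \<noteq> {}"
      using assms n0 by (simp_all add: B_def)
    then show ?thesis
      by (meson analytic_inE)
  qed
  then obtain p :: "nat \<Rightarrow> (nat \<Rightarrow> nat) \<Rightarrow> 'a"
    where p: "\<And>n. continuous_map euclidean T (p n)" "\<And>n. range (p n) = B n"
    by metis
  define q where "q z = p (z 0) (\<lambda>k. z (Suc k))" for z
  have "continuous_on UNIV (\<lambda>z k. z (Suc k) :: nat)"
    by (rule continuous_on_coordinatewise_then_product) (rule continuous_on_product_coordinates)
  then have "continuous_map euclidean T (\<lambda>z. p n (\<lambda>k. z (Suc k)))" for n
    using continuous_map_compose [OF _ p(1), of euclidean "\<lambda>z k. z (Suc k)"] by (simp add: o_def)
  then have "continuous_map euclidean T q"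
    unfolding q_def
    by (rule continuous_map_nat_cases [OF continuous_on_product_coordinates])
  moreover have "range q = (\<Union>n. A n)"
  proof -
    have "range q = (\<Union>n. range (p n))"
    proof safe
      fix z show "q z \<in> (\<Union>n. range (p n))" by (auto simp: q_def)
    next
      fix n z
      have "p n z = q (\<lambda>k. case k of 0 \<Rightarrow> n | Suc k \<Rightarrow> z k)" by (simp add: q_def)
      then show "p n z \<in> range q" by blast
    qed
    also have "\<dots> = (\<Union>n. A n)"
      using n0 by (auto simp: p(2) B_def split: if_splits)
    finally show ?thesis .
  qed
  ultimately show ?thesis
    unfolding analytic_in_def by blast
qed (auto simp: analytic_in_def)

lemma analytic_in_Un:
  assumes "analytic_in T A" "analytic_in T B"
  shows "analytic_in T (A \<union> B)"
proof -
  have "A \<union> B = (\<Union>n::nat. if n = 0 then A else B)"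
    by (auto split: if_splits)
  then show ?thesis
    using analytic_in_UN [of T "\<lambda>n. if n = 0 then A else B"] assms by simp
qed

text \<open>A point of the Baire space is read as a list of instructions that moves along a dense
  sequence, ignoring every move that is too long; the positions always converge.\<close>

lemma (in Metric_space) analytic_in_complete:
  assumes "mcomplete" and dd: "range dd \<subseteq> M"
    and dense: "\<And>x e. x \<in> M \<Longrightarrow> 0 < e \<Longrightarrow> \<exists>i::nat. d (dd i) x < e"
  shows "analytic_in mtopology M"
proof -
  define xs where
    "xs z = rec_nat (dd (z 0)) (\<lambda>n x. if d (dd (z (Suc n))) x < (1/2)^n then dd (z (Suc n)) else x)"
    for z :: "nat \<Rightarrow> nat"
  have xs_0 [simp]: "xs z 0 = dd (z 0)" for z
    by (simp add: xs_def)
  have xs_Suc: "xs z (Suc n) = (if d (dd (z (Suc n))) (xs z n) < (1/2)^n then dd (z (Suc n)) else xs z n)"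
    for z n by (simp add: xs_def)
  have ddM: "dd i \<in> M" for i
    using dd by auto
  have xsM: "xs z n \<in> M" for z n
    by (induction n) (auto simp: xs_Suc ddM)
  have step: "d (xs z n) (xs z (Suc n)) \<le> (1/2)^n" for z n
    using xsM [of z n] by (auto simp: xs_Suc commute)
  \<comment> \<open>Subtracting the tail of the geometric series is what lets the induction on
    \<open>k\<close> close.\<close>
  have bound: "d (xs z n) (xs z (n + k)) \<le> 2 * (1/2)^n - 2 * (1/2)^(n + k)" for z n k
  proof (induction k)
    case (Suc k)
    have "d (xs z n) (xs z (Suc (n + k))) \<le> d (xs z n) (xs z (n + k)) + d (xs z (n + k)) (xs z (Suc (n + k)))"
      by (rule triangle) (auto simp: xsM)
    then show ?case
      using Suc step [of z "n + k"] by simp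
  qed (simp add: xsM)
  have bound2: "d (xs z n) (xs z m) \<le> 2 * (1/2)^n" if "n \<le> m" for z n m
  proof -
    have "2 * (1/2)^n - 2 * (1/2)^m \<le> 2 * (1/2::real)^n" by simp
    then show ?thesis
      using bound [of z n "m - n"] that by (simp only: le_add_diff_inverse)
  qed
  have small: "\<exists>n. 4 * (1/2)^n < e" if "e > 0" for e :: real
    using real_arch_pow_inv [of "e/4" "1/2"] that by (auto simp: field_simps)
  have Cauchy: "MCauchy (xs z)" for z
    unfolding MCauchy_def
  proof (intro conjI allI impI)
    fix e :: real assume "e > 0"
    then obtain N where N: "4 * (1/2)^N < e" using small by blast
    have "d (xs z n) (xs z n') < e" if "N \<le> n" "N \<le> n'" for n n'
    proof -
      have "d (xs z n) (xs z n') \<le> d (xs z n) (xs z N) + d (xs z N) (xs z n')"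
        by (rule triangle) (auto simp: xsM)
      then show ?thesis
        using bound2 [OF that(1), of z] bound2 [OF that(2), of z] N by (simp add: commute)
    qed
    then show "\<exists>N. \<forall>n n'. N \<le> n \<longrightarrow> N \<le> n' \<longrightarrow> d (xs z n) (xs z n') < e"
      by blast
  qed (auto simp: xsM)
  then have "\<exists>l. limitin mtopology (xs z) l sequentially" for z
    using \<open>mcomplete\<close> unfolding mcomplete_def by blast
  then obtain p where lim: "\<And>z. limitin mtopology (xs z) (p z) sequentially"
    by metis
  then have pM: "p z \<in> M" for z
    by (simp add: limit_metric_sequentially)
  have dp: "d (xs z n) (p z) \<le> 2 * (1/2)^n" for z n
  proof (rule field_le_epsilon)
    fix e :: real assume "e > 0"
    then obtain N where N: "\<And>m. m \<ge> N \<Longrightarrow> d (xs z m) (p z) < e"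
      using lim [of z] unfolding limit_metric_sequentially by blast
    have "d (xs z n) (p z) \<le> d (xs z n) (xs z (max n N)) + d (xs z (max n N)) (p z)"
      by (rule triangle) (auto simp: xsM pM)
    then show "d (xs z n) (p z) \<le> 2 * (1/2)^n + e"
      using N [of "max n N"] bound2 [of n "max n N" z] by simp
  qed
  have local: "xs w n = xs z n" if "\<And>i. i \<le> n \<Longrightarrow> w i = z i" for w z n
    using that by (induction n) (auto simp: xs_Suc)
  have "continuous_map euclidean mtopology p"
    unfolding continuous_map_euclidean_iff
  proof (intro conjI allI impI)
    show "range p \<subseteq> topspace mtopology"
      using pM by auto
    fix U assume U: "openin mtopology U"
    show "open (p -` U)"
      unfolding open_nat_fun_iff
    proof
      fix z assume "z \<in> p -` U"
      then obtain e where e: "e > 0" "mball (p z) e \<subseteq> U"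
        using U unfolding openin_mtopology by auto
      obtain n where n: "4 * (1/2)^n < e"
        using small e by blast
      have "w \<in> p -` U" if w: "w \<in> agree_upto z (Suc n)" for w
      proof -
        have "xs w n = xs z n"
          using w by (intro local) (auto simp: agree_upto_def)
        then have "d (p z) (p w) \<le> d (p z) (xs z n) + d (xs w n) (p w)"
          using triangle [of "p z" "xs z n" "p w"] by (simp add: pM xsM)
        then have "d (p z) (p w) < e"
          using dp [of z n] dp [of w n] n by (simp add: commute)
        then show ?thesis
          using e pM by auto
      qed
      then show "\<exists>n. agree_upto z n \<subseteq> p -` U"
        by blast
    qed
  qed
  moreover have "x \<in> range p" if x: "x \<in> M" for x
  proof -
    \<comment> \<open>The factor 1/4 brings consecutive approximants closer than
      \<open>(1/4 + 1/8) * (1/2)^n\<close>, so no move is ever refused.\<close>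
    have "\<exists>i. d (dd i) x < (1/2)^n / 4" for n
      by (intro dense x) simp
    then obtain z where z: "\<And>n. d (dd (z n)) x < (1/2)^n / 4"
      by metis
    have xz: "xs z n = dd (z n)" for n
    proof (induction n)
      case (Suc n)
      have "d (dd (z (Suc n))) (dd (z n)) \<le> d (dd (z (Suc n))) x + d (dd (z n)) x"
        using triangle [of "dd (z (Suc n))" x "dd (z n)"] by (simp add: ddM x commute)
      also have "\<dots> < (1/2)^n"
        using z [of n] z [of "Suc n"] zero_less_power [of "1/2::real" n]
        by (simp only: power_Suc) linarith
      finally show ?case
        by (simp add: xs_Suc Suc)
    qed simp
    have "d (p z) x \<le> e" if e: "e > 0" for e :: real
    proof -
      obtain n where n: "4 * (1/2)^n < e"
        using small [OF e] by blast
      have "d (p z) x \<le> d (xs z n) (p z) + d (xs z n) x"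
        using triangle [of "p z" "xs z n" x] by (simp add: pM x xsM commute)
      then show ?thesis
        using dp [of z n] z [of n] n zero_less_power [of "1/2::real" n] unfolding xz by linarith
    qed
    then have "d (p z) x \<le> 0"
      using field_le_epsilon [of "d (p z) x" 0] by simp
    then have "p z = x"
      using pM x zero by (metis nonneg order_antisym)
    then show ?thesis by blast
  qed
  then have "range p = M"
    using pM by blast
  ultimately show ?thesis
    unfolding analytic_in_def by blast
qed

definition polish_top :: "'a topology \<Rightarrow> bool" where
  "polish_top T \<longleftrightarrow> completely_metrizable_space T \<and> second_countable T"

lemma analytic_in_topspace:
  assumes "polish_top T"
  shows "analytic_in T (topspace T)"
proof (cases "topspace T = {}")
  case False
  obtain M d where "Metric_space M d" and complete: "Metric_space.mcomplete M d"
    and T: "T = Metric_space.mtopology M d"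
    using assms unfolding polish_top_def completely_metrizable_space_def by auto
  interpret Metric_space M d by fact
  obtain C where C: "countable C" "C \<subseteq> M" "mtopology closure_of C = M"
    using second_countable_imp_separable_space [of T] assms
    by (auto simp: polish_top_def separable_space_def T)
  have "C \<noteq> {}"
    using C False T by auto
  have "\<exists>i. d (from_nat_into C i) x < e" if "x \<in> M" "e > 0" for x e
  proof -
    have "x \<in> mtopology closure_of C"
      using C(3) \<open>x \<in> M\<close> by simp
    then obtain y where "y \<in> C" "y \<in> mball x e"
      using \<open>e > 0\<close> unfolding metric_closure_of by blast
    then show ?thesis
      using from_nat_into_surj [OF C(1)] by (metis commute in_mball)
  qed
  moreover have "range (from_nat_into C) \<subseteq> M"
    using C range_from_nat_into [OF \<open>C \<noteq> {}\<close>] by auto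
  ultimately show ?thesis
    using analytic_in_complete [OF complete] T by simp
qed simp

lemma polish_top_Hausdorff: "polish_top T \<Longrightarrow> Hausdorff_space T"
  by (simp add: polish_top_def completely_metrizable_imp_metrizable_space metrizable_imp_Hausdorff_space)

lemma polish_top_gdelta:
  assumes "polish_top T" "gdelta_in T S"
  shows "polish_top (subtopology T S)"
  using assms
  by (simp add: polish_top_def completely_metrizable_space_gdelta_in second_countable_subtopology)

text \<open>A G-delta subset of a Polish space is Polish in its own topology, so it is itself an
  image of the Baire space; this covers open and closed sets at once.\<close>

lemma analytic_in_gdelta:
  assumes "polish_top T" "gdelta_in T S"
  shows "analytic_in T S"
proof -
  have "analytic_in (subtopology T S) S"
    using analytic_in_topspace [OF polish_top_gdelta [OF assms]] gdelta_in_subset [OF assms(2)]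
    by (simp add: Int_absorb1)
  then show ?thesis
    using analytic_in_image [of "subtopology T S" S T "\<lambda>x. x"]
      continuous_map_from_subtopology [OF continuous_map_id, of T S] by (simp add: id_def)
qed

lemma analytic_in_open: "polish_top T \<Longrightarrow> openin T S \<Longrightarrow> analytic_in T S"
  by (simp add: analytic_in_gdelta open_imp_gdelta_in)

lemma analytic_in_closed: "polish_top T \<Longrightarrow> closedin T S \<Longrightarrow> analytic_in T S"
  by (simp add: analytic_in_gdelta closed_imp_gdelta_in polish_top_def
      completely_metrizable_imp_metrizable_space)

lemma polish_top_euclidean: "polish_top (euclidean :: 'a::polish_space topology)"
  by (simp add: polish_top_def completely_metrizable_space_euclidean second_countable_euclidean)

lemma polish_top_powertop:
  assumes "polish_top (euclidean :: 'a::second_countable_topology topology)"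
  shows "polish_top (euclidean :: (nat \<Rightarrow> 'a) topology)"
proof -
  have "completely_metrizable_space (product_topology (\<lambda>i. euclidean :: 'a topology) (UNIV :: nat set))"
    unfolding completely_metrizable_space_product_topology
    using assms by (simp add: polish_top_def)
  then have "completely_metrizable_space (euclidean :: (nat \<Rightarrow> 'a) topology)"
    unfolding euclidean_product_topology .
  then show ?thesis
    by (simp add: polish_top_def second_countable_euclidean)
qed

lemma polish_top_prod:
  assumes "polish_top (euclidean :: 'a::second_countable_topology topology)"
    and "polish_top (euclidean :: 'b::second_countable_topology topology)"
  shows "polish_top (euclidean :: ('a \<times> 'b) topology)"
proof -
  have "completely_metrizable_space (prod_topology (euclidean :: 'a topology) (euclidean :: 'b topology))"
    unfolding completely_metrizable_space_prod_topology
    using assms by (simp add: polish_top_def)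
  then have "completely_metrizable_space (euclidean :: ('a \<times> 'b) topology)"
    unfolding prod_topology_euclidean .
  then show ?thesis
    by (simp add: polish_top_def second_countable_euclidean)
qed

lemma polish_top_nat: "polish_top (euclidean :: nat topology)"
proof -
  have "discrete_topology UNIV = (euclidean :: nat topology)"
    by (rule discrete_topology_unique [THEN iffD2]) (auto simp: open_discrete)
  then have "completely_metrizable_space (euclidean :: nat topology)"
    using completely_metrizable_space_discrete_topology [of "UNIV :: nat set"] by argo
  then show ?thesis
    by (simp add: polish_top_def second_countable_euclidean)
qed

lemma polish_top_nat_fun: "polish_top (euclidean :: (nat \<Rightarrow> nat) topology)"
  by (intro polish_top_powertop polish_top_nat)

text \<open>In a Hausdorff space, the sequences of parameters that name the same point in all
  \<open>A n\<close> form a closed subset of the countable power of the Baire space. That power is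
  Polish, and evaluating the zeroth parameter maps the closed set onto the intersection.\<close>

lemma analytic_in_Int_countable:
  assumes T: "Hausdorff_space T" and A: "\<And>n::nat. analytic_in T (A n)"
  shows "analytic_in T (\<Inter>n. A n)"
proof (cases "(\<Inter>n. A n) = {}")
  case False
  then have "\<exists>p :: (nat \<Rightarrow> nat) \<Rightarrow> 'a. continuous_map euclidean T p \<and> range p = A n" for n
    using A [of n] by (auto simp: analytic_in_def)
  then obtain p :: "nat \<Rightarrow> (nat \<Rightarrow> nat) \<Rightarrow> 'a"
    where p: "\<And>n. continuous_map euclidean T (p n)" "\<And>n. range (p n) = A n"
    by metis
  define C where "C = {z. \<forall>n. p n (z n) = p 0 (z 0)}"
  have cont: "continuous_map euclidean T (\<lambda>z. p n (z n))" for n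
  proof -
    have "continuous_map euclidean euclidean (\<lambda>z::nat \<Rightarrow> nat \<Rightarrow> nat. z n)"
      unfolding continuous_map_iff_continuous2 by (rule continuous_on_product_coordinates)
    from continuous_map_compose [OF this p(1)] show ?thesis
      by (simp add: o_def)
  qed
  have "closed {z. p n (z n) = p 0 (z 0)}" for n
    using closedin_continuous_maps_eq [OF T cont [of n] cont [of 0]] by simp
  then have "closed (\<Inter>n. {z. p n (z n) = p 0 (z 0)})"
    by (intro closed_INT ballI)
  moreover have "(\<Inter>n. {z. p n (z n) = p 0 (z 0)}) = C"
    by (auto simp: C_def)
  ultimately have "closedin euclidean C"
    by simp
  then have "analytic_in euclidean C"
    by (rule analytic_in_closed [OF polish_top_powertop [OF polish_top_nat_fun]])
  then have "analytic_in T ((\<lambda>z. p 0 (z 0)) ` C)"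
    by (rule analytic_in_image [OF _ cont])
  moreover have "(\<lambda>z. p 0 (z 0)) ` C = (\<Inter>n. A n)"
  proof safe
    fix z n assume "z \<in> C"
    then show "p 0 (z 0) \<in> A n"
      using p(2) [of n] by (metis (mono_tags, lifting) C_def mem_Collect_eq rangeI)
  next
    fix x assume "x \<in> (\<Inter>n. A n)"
    then have xp: "x \<in> range (p n)" for n
      by (simp add: p(2))
    define z where "z n = (SOME w. p n w = x)" for n
    have z: "p n (z n) = x" for n
    proof -
      obtain w where "x = p n w"
        using xp by (rule rangeE)
      then show ?thesis
        unfolding z_def by (intro someI [of "\<lambda>w. p n w = x"]) (rule sym)
    qed
    show "x \<in> (\<lambda>z. p 0 (z 0)) ` C"
    proof (rule image_eqI)
      show "x = p 0 (z 0)" by (rule z [symmetric])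
      show "z \<in> C" by (simp add: C_def z)
    qed
  qed
  ultimately show ?thesis by simp
qed simp

lemma analytic_in_Int:
  assumes "Hausdorff_space T" "analytic_in T A" "analytic_in T B"
  shows "analytic_in T (A \<inter> B)"
proof -
  have "A \<inter> B = (\<Inter>n::nat. if n = 0 then A else B)"
    by (auto split: if_splits)
  then show ?thesis
    using analytic_in_Int_countable [of T "\<lambda>n. if n = 0 then A else B"] assms by simp
qed

lemma analytic_in_Times:
  assumes A: "analytic_in T A" and B: "analytic_in T' B"
  shows "analytic_in (prod_topology T T') (A \<times> B)"
proof (cases "A = {} \<or> B = {}")
  case False
  obtain p :: "(nat \<Rightarrow> nat) \<Rightarrow> _" where p: "continuous_map euclidean T p" "range p = A"
    using analytic_inE [OF A] False by blast
  obtain q :: "(nat \<Rightarrow> nat) \<Rightarrow> _" where q: "continuous_map euclidean T' q" "range q = B"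
    using analytic_inE [OF B] False by blast
  have "analytic_in euclidean (UNIV :: ((nat \<Rightarrow> nat) \<times> (nat \<Rightarrow> nat)) set)"
    by (rule analytic_in_closed [OF polish_top_prod [OF polish_top_nat_fun polish_top_nat_fun]]) simp
  moreover have "continuous_map euclidean (prod_topology T T') (\<lambda>z. (p (fst z), q (snd z)))"
  proof -
    have "continuous_map euclidean euclidean (fst :: (nat \<Rightarrow> nat) \<times> (nat \<Rightarrow> nat) \<Rightarrow> _)"
         "continuous_map euclidean euclidean (snd :: (nat \<Rightarrow> nat) \<times> (nat \<Rightarrow> nat) \<Rightarrow> _)"
      unfolding continuous_map_iff_continuous2
      by (rule continuous_on_fst [OF continuous_on_id], rule continuous_on_snd [OF continuous_on_id])
    then show ?thesis
      using continuous_map_compose [OF _ p(1)] continuous_map_compose [OF _ q(1)]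
      unfolding continuous_map_pairwise o_def fst_conv snd_conv by blast
  qed
  ultimately have "analytic_in (prod_topology T T') (range (\<lambda>z. (p (fst z), q (snd z))))"
    by (rule analytic_in_image)
  moreover have "range (\<lambda>z. (p (fst z), q (snd z))) = A \<times> B"
  proof -
    have "(p z, q w) \<in> range (\<lambda>z. (p (fst z), q (snd z)))" for z w
      by (rule range_eqI [of _ _ "(z, w)"]) simp
    then show ?thesis
      unfolding p(2) [symmetric] q(2) [symmetric] by blast
  qed
  ultimately show ?thesis by simp
qed auto

section \<open>Borel sets and Lusin separation\<close>

abbreviation borel_sets_of :: "'a topology \<Rightarrow> 'a set set" where
  "borel_sets_of T \<equiv> sigma_sets (topspace T) {U. openin T U}"

lemma openin_subset_Pow: "{U. openin T U} \<subseteq> Pow (topspace T)"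
  by (auto dest: openin_subset)

lemma borel_sets_of_Int:
  assumes "A \<in> borel_sets_of T" "B \<in> borel_sets_of T"
  shows "A \<inter> B \<in> borel_sets_of T"
proof -
  interpret sigma_algebra "topspace T" "borel_sets_of T"
    by (rule sigma_algebra_sigma_sets [OF openin_subset_Pow])
  show ?thesis
    using assms by (rule Int)
qed

text \<open>The induction carries the complement along: taking complements swaps the two halves, and
  a union becomes a countable intersection of complements.\<close>

lemma analytic_in_borel:
  assumes T: "polish_top T" and "B \<in> borel_sets_of T"
  shows "analytic_in T B"
proof -
  from assms(2) have "analytic_in T B \<and> analytic_in T (topspace T - B)"
  proof (induction rule: sigma_sets.induct)
    case (Basic U)
    then show ?case
      using T by (auto intro: analytic_in_open analytic_in_closed)
  next
    case (Compl B)
    then have "topspace T - (topspace T - B) = B"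
      by (auto dest: analytic_in_subset)
    with Compl show ?case by simp
  next
    case (Union B)
    have "topspace T - (\<Union>n. B n) = (\<Inter>n. topspace T - B n)"
      by auto
    with Union show ?case
      using analytic_in_UN [of T B] analytic_in_Int_countable [of T "\<lambda>n. topspace T - B n"]
      by (simp add: polish_top_Hausdorff [OF T])
  qed (simp add: analytic_in_topspace [OF T])
  then show ?thesis ..
qed

text \<open>Separability passes from countably many pieces to their unions, so inseparable sets have
  inseparable pieces with one more entry prescribed. The two branches found this way lead to
  distinct points, and by continuity disjoint neighbourhoods of these separate all late
  pieces.\<close>

lemma analytic_separation:
  assumes T: "Hausdorff_space T" and A: "analytic_in T A" and B: "analytic_in T B" and "A \<inter> B = {}"
  shows "\<exists>C \<in> borel_sets_of T. A \<subseteq> C \<and> B \<inter> C = {}"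
proof (cases "A = {} \<or> B = {}")
  case True
  moreover have "{} \<in> borel_sets_of T" "topspace T \<in> borel_sets_of T"
    by (auto intro: sigma_sets.Empty sigma_sets_top)
  ultimately show ?thesis
    using analytic_in_subset [OF A] by blast
next
  case False
  obtain p :: "(nat \<Rightarrow> nat) \<Rightarrow> _" where p: "continuous_map euclidean T p" "range p = A"
    using analytic_inE [OF A] False by blast
  obtain q :: "(nat \<Rightarrow> nat) \<Rightarrow> _" where q: "continuous_map euclidean T q" "range q = B"
    using analytic_inE [OF B] False by blast
  define sep where "sep P Q \<longleftrightarrow> (\<exists>C \<in> borel_sets_of T. P \<subseteq> C \<and> Q \<inter> C = {})" for P Q
  have sep_UN: "sep (\<Union>i. P i) (\<Union>j. Q j)" if "\<And>i j. sep (P i) (Q j)"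
    for P Q :: "nat \<Rightarrow> _"
  proof -
    define C where "C i j = (SOME C. C \<in> borel_sets_of T \<and> P i \<subseteq> C \<and> Q j \<inter> C = {})" for i j
    have "C i j \<in> borel_sets_of T \<and> P i \<subseteq> C i j \<and> Q j \<inter> C i j = {}" for i j
      using that [of i j] unfolding sep_def C_def Bex_def by (rule someI_ex)
    then have C: "\<And>i j. C i j \<in> borel_sets_of T" "\<And>i j. P i \<subseteq> C i j" "\<And>i j. Q j \<inter> C i j = {}"
      by blast+
    have "(\<Union>i. \<Inter>j. C i j) \<in> borel_sets_of T"
      by (intro sigma_sets.Union sigma_sets_Inter [OF openin_subset_Pow] C)
    moreover have "(\<Union>i. P i) \<subseteq> (\<Union>i. \<Inter>j. C i j)"
      using C(2) by blast
    moreover have "(\<Union>j. Q j) \<inter> (\<Union>i. \<Inter>j. C i j) = {}"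
      using C(3) by blast
    ultimately show ?thesis
      unfolding sep_def by blast
  qed
  have "sep A B"
  proof (rule ccontr)
    assume "\<not> sep A B"
    let ?P = "\<lambda>n zw. \<not> sep (p ` agree_upto (fst zw) n) (q ` agree_upto (snd zw) n)"
    let ?Q = "\<lambda>n zw zw'. (\<forall>i<n. fst zw' i = fst zw i) \<and> (\<forall>i<n. snd zw' i = snd zw i)"
    have "\<exists>f :: nat \<Rightarrow> (nat \<Rightarrow> nat) \<times> (nat \<Rightarrow> nat). \<forall>n. ?P n (f n) \<and> ?Q n (f n) (f (Suc n))"
    proof (rule dependent_nat_choice)
      show "\<exists>zw. ?P 0 zw"
        using \<open>\<not> sep A B\<close> p(2) q(2) by simp
    next
      fix zw :: "(nat \<Rightarrow> nat) \<times> (nat \<Rightarrow> nat)" and n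
      assume "?P n zw"
      then have "\<not> sep (\<Union>a. p ` agree_upto ((fst zw)(n := a)) (Suc n))
                   (\<Union>b. q ` agree_upto ((snd zw)(n := b)) (Suc n))"
        by (simp only: agree_upto_Suc [of _ n] image_UN simp_thms)
      then obtain a b where "\<not> sep (p ` agree_upto ((fst zw)(n := a)) (Suc n))
                                    (q ` agree_upto ((snd zw)(n := b)) (Suc n))"
        using sep_UN [of "\<lambda>a. p ` agree_upto ((fst zw)(n := a)) (Suc n)"
            "\<lambda>b. q ` agree_upto ((snd zw)(n := b)) (Suc n)"] by blast
      then show "\<exists>zw'. ?P (Suc n) zw' \<and> ?Q n zw zw'"
        by (intro exI [of _ "((fst zw)(n := a), (snd zw)(n := b))"]) auto
    qed
    then obtain f :: "nat \<Rightarrow> (nat \<Rightarrow> nat) \<times> (nat \<Rightarrow> nat)"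
      where f: "\<And>n. ?P n (f n)" "\<And>n. ?Q n (f n) (f (Suc n))"
      by blast
    \<comment> \<open>Entry \<open>n\<close> is chosen in passing to stage \<open>n + 1\<close> and
      never changes afterwards, so the branches are read off diagonally.\<close>
    define z w where "z n = fst (f (Suc n)) n" and "w n = snd (f (Suc n)) n" for n
    have stable: "fst (f (m + n)) i = fst (f n) i \<and> snd (f (m + n)) i = snd (f n) i" if "i < n" for m n i
      using that f(2) by (induction m) auto
    have zw: "fst (f n) i = z i \<and> snd (f n) i = w i" if "i < n" for n i
      using stable [of i "Suc i" "n - Suc i"] that by (simp add: z_def w_def)
    have nsep: "\<not> sep (p ` agree_upto z n) (q ` agree_upto w n)" for n
      using f(1) [of n] zw agree_upto_cong [of n "fst (f n)" z] agree_upto_cong [of n "snd (f n)" w]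
      by auto
    have "p z \<in> topspace T" "q w \<in> topspace T" "p z \<noteq> q w"
      using p q \<open>A \<inter> B = {}\<close> analytic_in_subset [OF A] analytic_in_subset [OF B] by auto
    then obtain U V where UV: "openin T U" "openin T V" "p z \<in> U" "q w \<in> V" "disjnt U V"
      using T unfolding Hausdorff_space_def by metis
    have "open (p -` U)" "open (q -` V)"
      using p(1) q(1) UV unfolding continuous_map_euclidean_iff by blast+
    then obtain m n where "agree_upto z m \<subseteq> p -` U" "agree_upto w n \<subseteq> q -` V"
      using UV unfolding open_nat_fun_iff by blast
    then have "p ` agree_upto z (max m n) \<subseteq> U" "q ` agree_upto w (max m n) \<subseteq> V"
      using agree_upto_mono [of m "max m n" z] agree_upto_mono [of n "max m n" w] by auto
    then have "sep (p ` agree_upto z (max m n)) (q ` agree_upto w (max m n))"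
      unfolding sep_def using UV by (intro bexI [of _ U]) (auto simp: disjnt_iff)
    then show False
      using nsep by blast
  qed
  then show ?thesis
    unfolding sep_def .
qed

section \<open>Borel sets on which a map is injective\<close>

locale polish_borel_map =
  fixes T :: "'x topology" and f :: "'x \<Rightarrow> 'y::polish_space"
  assumes polish: "polish_top T"
    and borel: "\<And>U. open U \<Longrightarrow> f -` U \<inter> topspace T \<in> borel_sets_of T"
begin

text \<open>The graph of \<open>f\<close> over \<open>A\<close> is analytic, because countably many
  Borel rectangles decide membership in it. Parametrising the graph instead of \<open>A\<close>
  makes both the point and its value continuous in the parameter, although \<open>f\<close> is only
  Borel.\<close>

lemma analytic_in_param:
  assumes A: "analytic_in T A" and "A \<noteq> {}"
  obtains a :: "(nat \<Rightarrow> nat) \<Rightarrow> 'x"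
  where "continuous_map euclidean T a" "continuous_on UNIV (\<lambda>z. f (a z))" "range a = A"
proof -
  obtain \<B> :: "'y set set" where \<B>: "countable \<B>" "topological_basis \<B>"
    using ex_countable_basis by blast
  define U where "U = from_nat_into \<B>"
  have "\<B> \<noteq> {}"
    using topological_basisE [OF \<B>(2) open_UNIV UNIV_I] by blast
  then have U: "U n \<in> \<B>" for n
    by (simp add: U_def from_nat_into)
  have openU: "open (U n)" for n
    using topological_basis_open [OF \<B>(2) U] .
  have sep: "\<exists>n. y \<in> U n \<and> y' \<notin> U n" if ne: "y \<noteq> y'" for y y'
  proof -
    obtain O' where "open O'" "y \<in> O'" "y' \<notin> O'"
      using t1_space_class.t1_space [OF ne] by blast
    then obtain B where B: "B \<in> \<B>" "y \<in> B" "B \<subseteq> O'"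
      using topological_basisE [OF \<B>(2)] by metis
    then obtain n where "U n = B"
      using from_nat_into_surj [OF \<B>(1)] unfolding U_def by blast
    with B \<open>y' \<notin> O'\<close> show ?thesis by blast
  qed
  \<comment> \<open>\<open>G n\<close> collects the pairs \<open>(x, y)\<close> for which
    \<open>U n\<close> does not distinguish \<open>f x\<close> from \<open>y\<close>; the sets
    \<open>U n\<close> separate points, so only the graph survives all of them.\<close>
  define G where "G n = (f -` U n \<inter> topspace T) \<times> U n \<union> (topspace T - (f -` U n \<inter> topspace T)) \<times> (- U n)" for n
  have "analytic_in (prod_topology T euclidean) (G n)" for n
  proof -
    have "closedin euclidean (- U n)"
      using openU [of n] by (simp add: closed_def)
    moreover have "openin euclidean (U n)"
      using openU [of n] by simp
    ultimately show ?thesis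
      unfolding G_def
      by (intro analytic_in_Un analytic_in_Times analytic_in_borel [OF polish] sigma_sets.Compl
          borel openU analytic_in_open [OF polish_top_euclidean] analytic_in_closed [OF polish_top_euclidean])
  qed
  moreover have H: "Hausdorff_space (prod_topology T (euclidean :: 'y topology))"
    by (simp add: Hausdorff_space_prod_topology polish_top_Hausdorff [OF polish])
  ultimately have "analytic_in (prod_topology T euclidean) (\<Inter>n. G n)"
    by (intro analytic_in_Int_countable)
  moreover have "analytic_in (prod_topology T euclidean) (A \<times> (UNIV :: 'y set))"
    by (rule analytic_in_Times [OF A analytic_in_closed [OF polish_top_euclidean]]) simp
  ultimately have "analytic_in (prod_topology T euclidean) ((\<Inter>n. G n) \<inter> A \<times> UNIV)"
    using analytic_in_Int [OF H] by blast
  moreover have "(\<Inter>n. G n) \<inter> A \<times> UNIV = (\<lambda>x. (x, f x)) ` A"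
  proof (intro equalityI subsetI)
    fix xy assume "xy \<in> (\<Inter>n. G n) \<inter> A \<times> UNIV"
    then obtain x y where xy: "xy = (x, y)" "x \<in> A" "\<And>n. (x, y) \<in> G n"
      by blast
    then have "f x \<in> U n \<longleftrightarrow> y \<in> U n" for n
      using xy(3) [of n] by (auto simp: G_def)
    then have "f x = y"
      using sep by blast
    then show "xy \<in> (\<lambda>x. (x, f x)) ` A"
      using xy by blast
  next
    fix xy assume "xy \<in> (\<lambda>x. (x, f x)) ` A"
    then show "xy \<in> (\<Inter>n. G n) \<inter> A \<times> UNIV"
      using analytic_in_subset [OF A] by (auto simp: G_def)
  qed
  ultimately have "analytic_in (prod_topology T euclidean) ((\<lambda>x. (x, f x)) ` A)"
    by simp
  moreover have "(\<lambda>x. (x, f x)) ` A \<noteq> {}"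
    using \<open>A \<noteq> {}\<close> by simp
  ultimately obtain p :: "(nat \<Rightarrow> nat) \<Rightarrow> 'x \<times> 'y"
    where p: "continuous_map euclidean (prod_topology T euclidean) p" "range p = (\<lambda>x. (x, f x)) ` A"
    by (rule analytic_inE)
  have "p z \<in> (\<lambda>x. (x, f x)) ` A" for z
    using p(2) by blast
  then have snd: "snd (p z) = f (fst (p z))" for z
    by (metis (no_types, lifting) fst_conv imageE snd_conv)
  show ?thesis
  proof
    show "continuous_map euclidean T (\<lambda>z. fst (p z))"
      using p(1) unfolding continuous_map_pairwise o_def by blast
    have "continuous_map euclidean euclidean (\<lambda>z. snd (p z))"
      using p(1) unfolding continuous_map_pairwise o_def by blast
    then show "continuous_on UNIV (\<lambda>z. f (fst (p z)))"
      by (simp add: snd)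
    have "range (\<lambda>z. fst (p z)) = fst ` range p"
      by (simp add: image_image)
    then show "range (\<lambda>z. fst (p z)) = A"
      by (simp add: p(2) image_image)
  qed
qed

text \<open>On pairs of parameters, equality of values is a closed condition and difference of
  points an open one; the set is the projection of their intersection. The flag \<open>b\<close>
  serves two uses: different partners for injectivity, arbitrary partners for common values of
  several sets.\<close>

lemma analytic_in_partner:
  assumes A: "analytic_in T A" and C: "analytic_in T C"
  shows "analytic_in T {x \<in> A. \<exists>x'\<in>C. f x' = f x \<and> (b \<longrightarrow> x \<noteq> x')}"
proof (cases "A = {} \<or> C = {}")
  case False
  obtain a :: "(nat \<Rightarrow> nat) \<Rightarrow> 'x" where a: "continuous_map euclidean T a"
    "continuous_on UNIV (\<lambda>z. f (a z))" "range a = A"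
    using analytic_in_param [OF A] False by blast
  obtain c :: "(nat \<Rightarrow> nat) \<Rightarrow> 'x" where c: "continuous_map euclidean T c"
    "continuous_on UNIV (\<lambda>z. f (c z))" "range c = C"
    using analytic_in_param [OF C] False by blast
  have proj: "continuous_map euclidean euclidean (fst :: (nat \<Rightarrow> nat) \<times> (nat \<Rightarrow> nat) \<Rightarrow> _)"
             "continuous_map euclidean euclidean (snd :: (nat \<Rightarrow> nat) \<times> (nat \<Rightarrow> nat) \<Rightarrow> _)"
    unfolding continuous_map_iff_continuous2
    by (rule continuous_on_fst [OF continuous_on_id], rule continuous_on_snd [OF continuous_on_id])
  have a1: "continuous_map euclidean T (\<lambda>z::(nat \<Rightarrow> nat) \<times> (nat \<Rightarrow> nat). a (fst z))"
    using continuous_map_compose [OF proj(1) a(1)] by (simp add: o_def)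
  have c1: "continuous_map euclidean T (\<lambda>z::(nat \<Rightarrow> nat) \<times> (nat \<Rightarrow> nat). c (snd z))"
    using continuous_map_compose [OF proj(2) c(1)] by (simp add: o_def)
  have fa: "continuous_on UNIV (\<lambda>z::(nat \<Rightarrow> nat) \<times> (nat \<Rightarrow> nat). f (a (fst z)))"
    by (rule continuous_on_compose2 [OF a(2) continuous_on_fst [OF continuous_on_id]]) simp
  have fc: "continuous_on UNIV (\<lambda>z::(nat \<Rightarrow> nat) \<times> (nat \<Rightarrow> nat). f (c (snd z)))"
    by (rule continuous_on_compose2 [OF c(2) continuous_on_snd [OF continuous_on_id]]) simp
  note P = polish_top_prod [OF polish_top_nat_fun polish_top_nat_fun]
  have "closed {z::(nat \<Rightarrow> nat) \<times> (nat \<Rightarrow> nat). f (c (snd z)) = f (a (fst z))}"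
    by (rule closed_Collect_eq [OF fc fa])
  then have K: "analytic_in euclidean {z::(nat \<Rightarrow> nat) \<times> (nat \<Rightarrow> nat). f (c (snd z)) = f (a (fst z))}"
    by (intro analytic_in_closed [OF P]) simp
  have "closed {z::(nat \<Rightarrow> nat) \<times> (nat \<Rightarrow> nat). a (fst z) = c (snd z)}"
    using closedin_continuous_maps_eq [OF polish_top_Hausdorff [OF polish] a1 c1] by simp
  then have "open {z::(nat \<Rightarrow> nat) \<times> (nat \<Rightarrow> nat). b \<longrightarrow> a (fst z) \<noteq> c (snd z)}"
    by (cases b) (simp_all add: open_Collect_neg)
  then have L: "analytic_in euclidean {z::(nat \<Rightarrow> nat) \<times> (nat \<Rightarrow> nat). b \<longrightarrow> a (fst z) \<noteq> c (snd z)}"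
    by (intro analytic_in_open [OF P]) simp
  have "analytic_in T ((\<lambda>z. a (fst z)) ` ({z. f (c (snd z)) = f (a (fst z))} \<inter> {z. b \<longrightarrow> a (fst z) \<noteq> c (snd z)}))"
    by (rule analytic_in_image [OF analytic_in_Int [OF polish_top_Hausdorff [OF P] K L] a1])
  moreover have "(\<lambda>z. a (fst z)) ` ({z. f (c (snd z)) = f (a (fst z))} \<inter> {z. b \<longrightarrow> a (fst z) \<noteq> c (snd z)})
    = {x \<in> A. \<exists>x'\<in>C. f x' = f x \<and> (b \<longrightarrow> x \<noteq> x')}"
  proof (intro equalityI subsetI)
    fix x assume "x \<in> (\<lambda>z. a (fst z)) ` ({z. f (c (snd z)) = f (a (fst z))} \<inter> {z. b \<longrightarrow> a (fst z) \<noteq> c (snd z)})"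
    then show "x \<in> {x \<in> A. \<exists>x'\<in>C. f x' = f x \<and> (b \<longrightarrow> x \<noteq> x')}"
      using a(3) c(3) by blast
  next
    fix x assume "x \<in> {x \<in> A. \<exists>x'\<in>C. f x' = f x \<and> (b \<longrightarrow> x \<noteq> x')}"
    then obtain z w where "x = a z" "f (c w) = f (a z)" "b \<longrightarrow> a z \<noteq> c w"
      using a(3) c(3) by blast
    then show "x \<in> (\<lambda>z. a (fst z)) ` ({z. f (c (snd z)) = f (a (fst z))} \<inter> {z. b \<longrightarrow> a (fst z) \<noteq> c (snd z)})"
      by (intro image_eqI [of _ _ "(z, w)"]) auto
  qed
  ultimately show ?thesis by simp
qed auto

text \<open>Separating \<open>A\<close> from the set of points with a different partner in \<open>A\<close> yields a Borel set \<open>B1\<close>; a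
  second separation removes the points with a different partner in \<open>B1\<close>.\<close>

lemma analytic_inj_on_reflection:
  assumes A: "analytic_in T A" and inj: "inj_on f A"
  shows "\<exists>B \<in> borel_sets_of T. A \<subseteq> B \<and> inj_on f B"
proof -
  let ?E = "\<lambda>C. {x \<in> topspace T. \<exists>x'\<in>C. f x' = f x \<and> (True \<longrightarrow> x \<noteq> x')}"
  note H = polish_top_Hausdorff [OF polish]
  note an = analytic_in_partner [OF analytic_in_topspace [OF polish]]
  have "A \<inter> ?E A = {}"
    using inj by (auto dest: inj_onD)
  from analytic_separation [OF H A an [OF A] this]
  obtain B1 where B1: "B1 \<in> borel_sets_of T" "A \<subseteq> B1" "?E A \<inter> B1 = {}"
    by (elim bexE conjE)
  have B1T: "B1 \<subseteq> topspace T"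
    using B1(1) sigma_sets_into_sp [OF openin_subset_Pow] by blast
  have "x \<notin> ?E B1" if "x \<in> A" for x
  proof
    assume "x \<in> ?E B1"
    then obtain x' where "x' \<in> B1" "f x' = f x" "x \<noteq> x'"
      by blast
    then have "x' \<in> ?E A"
      using that B1T by force
    with \<open>x' \<in> B1\<close> B1(3) show False
      by blast
  qed
  then have "A \<inter> ?E B1 = {}"
    by blast
  from analytic_separation [OF H A an [OF analytic_in_borel [OF polish B1(1)]] this]
  obtain B2 where B2: "B2 \<in> borel_sets_of T" "A \<subseteq> B2" "?E B1 \<inter> B2 = {}"
    by (elim bexE conjE)
  \<comment> \<open>Two different points of \<open>B1 \<inter> B2\<close> with one value would be
    partners of each other in \<open>B1\<close>, and \<open>B2\<close> contains no such
    point.\<close>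
  have inj2: "inj_on f (B1 \<inter> B2)"
    using B1T B2(3) by (intro inj_onI) force
  have "B1 \<inter> B2 \<in> borel_sets_of T"
    by (rule borel_sets_of_Int [OF B1(1) B2(1)])
  then show ?thesis
    using Int_greatest [OF B1(2) B2(2)] inj2 by (intro bexI conjI)
qed


section \<open>Small sets and large families\<close>

definition small :: "'x set \<Rightarrow> bool" where
  "small B \<longleftrightarrow> (\<exists>b :: nat \<Rightarrow> 'x set. (\<forall>n. b n \<in> borel_sets_of T \<and> inj_on f (b n)) \<and> B = (\<Union>n. b n))"

lemma small_borel: "small B \<Longrightarrow> B \<in> borel_sets_of T"
  unfolding small_def by (auto intro: sigma_sets.Union)

lemma small_empty: "small {}"
  unfolding small_def by (intro exI [of _ "\<lambda>_. {}"]) (auto intro: sigma_sets.Empty)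

lemma small_inj: "B \<in> borel_sets_of T \<Longrightarrow> inj_on f B \<Longrightarrow> small B"
  unfolding small_def by (intro exI [of _ "\<lambda>_. B"]) auto

lemma small_UN:
  assumes "\<And>n::nat. small (B n)"
  shows "small (\<Union>n. B n)"
proof -
  have "\<forall>n. \<exists>b :: nat \<Rightarrow> 'x set. (\<forall>k. b k \<in> borel_sets_of T \<and> inj_on f (b k)) \<and> B n = (\<Union>k. b k)"
    using assms unfolding small_def by blast
  then obtain b :: "nat \<Rightarrow> nat \<Rightarrow> 'x set"
    where b: "\<forall>n. (\<forall>k. b n k \<in> borel_sets_of T \<and> inj_on f (b n k)) \<and> B n = (\<Union>k. b n k)"
    by (rule choice [THEN exE])
  show ?thesis
    unfolding small_def
  proof (intro exI conjI)
    show "\<forall>j. case_prod b (prod_decode j) \<in> borel_sets_of T \<and> inj_on f (case_prod b (prod_decode j))"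
      using b by (simp split: prod.split)
    have "(\<Union>j. case_prod b (prod_decode j)) = (\<Union>nk \<in> range prod_decode. case_prod b nk)"
      by simp
    also have "\<dots> = (\<Union>n. B n)"
      using b by (simp add: surj_prod_decode) auto
    finally show "(\<Union>n. B n) = (\<Union>j. case_prod b (prod_decode j))"
      by simp
  qed
qed

lemma small_Un:
  assumes "small A" "small B"
  shows "small (A \<union> B)"
proof -
  have "A \<union> B = (\<Union>n::nat. if n = 0 then A else B)"
    by (auto split: if_splits)
  then show ?thesis
    using small_UN [of "\<lambda>n. if n = 0 then A else B"] assms by simp
qed

text \<open>A property of the family as a whole: all nodes of one level of the Cantor scheme must
  keep a common value of \<open>f\<close> after the removal of any small set. Asking it of each node
  separately would not produce one fibre that meets all branches.\<close>

definition large :: "'i set \<Rightarrow> ('i \<Rightarrow> 'x set) \<Rightarrow> bool" where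
  "large I A \<longleftrightarrow> (\<forall>B. small B \<longrightarrow> (\<exists>y. \<forall>i\<in>I. \<exists>x \<in> A i - B. f x = y))"

text \<open>If every piece were defeated by a small set, the union of these sets would still be
  small and would defeat the original family.\<close>

lemma large_UN:
  assumes L: "large I A" and "u \<in> I" and A: "A u \<subseteq> (\<Union>n::nat. A' n)"
  shows "\<exists>n. large I (A(u := A' n))"
proof (rule ccontr)
  assume "\<nexists>n. large I (A(u := A' n))"
  then have "\<forall>n. \<exists>B. small B \<and> \<not> (\<exists>y. \<forall>i\<in>I. \<exists>x \<in> (A(u := A' n)) i - B. f x = y)"
    unfolding large_def by blast
  then obtain B where B: "\<forall>n. small (B n) \<and> \<not> (\<exists>y. \<forall>i\<in>I. \<exists>x \<in> (A(u := A' n)) i - B n. f x = y)"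
    by (rule choice [THEN exE])
  then have "small (\<Union>n. B n)"
    by (intro small_UN) blast
  then obtain y where y: "\<forall>i\<in>I. \<exists>x \<in> A i - (\<Union>n. B n). f x = y"
    using L unfolding large_def by blast
  with \<open>u \<in> I\<close> obtain x where x: "x \<in> A u - (\<Union>n. B n)" "f x = y"
    by blast
  then obtain n where "x \<in> A' n"
    using A by blast
  moreover have "\<forall>i\<in>I. \<exists>x \<in> A i - B n. f x = y"
    using y by blast
  ultimately have "\<forall>i\<in>I. \<exists>x \<in> (A(u := A' n)) i - B n. f x = y"
    using x by auto
  then show False
    using B by blast
qed

text \<open>Otherwise, outside a small set, the points of \<open>A u\<close> with partners in all the other \<open>A i\<close> form an
  analytic set on which \<open>f\<close> is injective, and this set is small by reflection.\<close>

lemma large_split: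
  fixes P Q :: "nat \<Rightarrow> 'x set"
  assumes L: "large I A" and "finite I" and an: "\<And>i. i \<in> I \<Longrightarrow> analytic_in T (A i)"
    and u: "u \<in> I" and v: "v \<notin> I"
    and PQ: "\<And>x x'. x \<in> topspace T \<Longrightarrow> x' \<in> topspace T \<Longrightarrow> x \<noteq> x' \<Longrightarrow> \<exists>n. x \<in> P n \<and> x' \<in> Q n"
  shows "\<exists>n. large (insert v I) (A(u := A u \<inter> P n, v := A u \<inter> Q n))"
proof (rule ccontr)
  let ?A = "\<lambda>n. A(u := A u \<inter> P n, v := A u \<inter> Q n)"
  assume "\<nexists>n. large (insert v I) (?A n)"
  then have "\<forall>n. \<exists>B. small B \<and> \<not> (\<exists>y. \<forall>i\<in>insert v I. \<exists>x \<in> ?A n i - B. f x = y)"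
    unfolding large_def by blast
  then obtain B where B: "\<forall>n. small (B n) \<and> \<not> (\<exists>y. \<forall>i\<in>insert v I. \<exists>x \<in> ?A n i - B n. f x = y)"
    by (rule choice [THEN exE])
  define B' where "B' = (\<Union>n. B n)"
  have B': "small B'"
    unfolding B'_def using B by (intro small_UN) blast
  have diff: "analytic_in T (A i - B')" if "i \<in> I" for i
  proof -
    have "A i - B' = A i \<inter> (topspace T - B')"
      using analytic_in_subset [OF an [OF that]] by blast
    then show ?thesis
      using analytic_in_Int [OF polish_top_Hausdorff [OF polish] an [OF that]
          analytic_in_borel [OF polish sigma_sets.Compl [OF small_borel [OF B']]]] by simp
  qed
  \<comment> \<open>Partners are demanded for one further member of the family at a time, so that
    \<open>analytic_in_partner\<close> applies at each step of the induction on
    \<open>J\<close>.\<close>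
  define S where "S J = {x \<in> A u - B'. \<forall>i\<in>J. \<exists>x' \<in> A i - B'. f x' = f x}" for J
  have "J \<subseteq> I \<longrightarrow> analytic_in T (S J)" if "finite J" for J
    using that
  proof (induction J rule: finite_induct)
    case empty
    have "S {} = A u - B'"
      by (auto simp: S_def)
    then show ?case
      using diff [OF u] by simp
  next
    case (insert i J)
    have "S (insert i J) = {x \<in> S J. \<exists>x'\<in>A i - B'. f x' = f x \<and> (False \<longrightarrow> x \<noteq> x')}"
      unfolding S_def by auto
    moreover have "analytic_in T {x \<in> S J. \<exists>x'\<in>A i - B'. f x' = f x \<and> (False \<longrightarrow> x \<noteq> x')}"
      if "insert i J \<subseteq> I"
      by (rule analytic_in_partner) (use insert that diff in auto)
    ultimately show ?case
      by simp
  qed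
  then have an_S: "analytic_in T (S (I - {u}))"
    using \<open>finite I\<close> by blast
  show False
  proof (cases "inj_on f (S (I - {u}))")
    case True
    from analytic_inj_on_reflection [OF an_S True]
    obtain C where C: "C \<in> borel_sets_of T" "S (I - {u}) \<subseteq> C" "inj_on f C"
      by (elim bexE conjE)
    then have "small (B' \<union> C)"
      by (intro small_Un B' small_inj)
    then obtain y where y: "\<forall>i\<in>I. \<exists>x \<in> A i - (B' \<union> C). f x = y"
      using L unfolding large_def by blast
    with u obtain x where x: "x \<in> A u - (B' \<union> C)" "f x = y"
      by blast
    have "x \<in> S (I - {u})"
      unfolding S_def using x y by blast
    then show False
      using C x by blast
  next
    case False
    then obtain x x' where x: "x \<in> S (I - {u})" "x' \<in> S (I - {u})" "f x = f x'" "x \<noteq> x'"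
      unfolding inj_on_def by blast
    then have "x \<in> topspace T" "x' \<in> topspace T"
      using analytic_in_subset [OF an_S] by blast+
    then obtain n where n: "x \<in> P n" "x' \<in> Q n"
      using PQ x(4) by blast
    have "B n \<subseteq> B'"
      unfolding B'_def by blast
    have "\<exists>x'' \<in> ?A n i - B n. f x'' = f x" if "i \<in> insert v I" for i
    proof -
      consider "i = v" | "i = u" "i \<noteq> v" | "i \<in> I - {u}" "i \<noteq> v"
        using \<open>i \<in> insert v I\<close> by blast
      then show ?thesis
      proof cases
        case 1
        then show ?thesis
          using x n \<open>B n \<subseteq> B'\<close> by (intro bexI [of _ x']) (auto simp: S_def)
      next
        case 2
        then show ?thesis
          using x n \<open>B n \<subseteq> B'\<close> by (intro bexI [of _ x]) (auto simp: S_def)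
      next
        case 3
        then obtain x'' where "x'' \<in> A i - B'" "f x'' = f x"
          using x(1) unfolding S_def by blast
        then show ?thesis
          using 3 \<open>B n \<subseteq> B'\<close> by (intro bexI [of _ x'']) auto
      qed
    qed
    then show False
      using B by blast
  qed
qed

end

section \<open>The Cantor scheme\<close>

text \<open>Refining a node needs a countable cover by clopen sets, hence an enumeration by codes of
  finite sequences; the padding by 0 lies beyond the prescribed length.\<close>

definition cylinder :: "nat \<Rightarrow> (nat \<Rightarrow> nat) set" where
  "cylinder k = (let l = from_nat k :: nat list in agree_upto (\<lambda>i. if i < length l then l ! i else 0) (length l))"

lemma cylinder_agree_upto: "\<exists>k. cylinder k = agree_upto z n"
proof -
  have "cylinder (to_nat (map z [0..<n])) = agree_upto z n"
    unfolding cylinder_def Let_def from_nat_to_nat by (auto intro!: agree_upto_cong)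
  then show ?thesis by blast
qed

lemma closed_agree_upto: "closed (agree_upto (z :: nat \<Rightarrow> nat) n)"
proof -
  have "\<exists>m. agree_upto w m \<subseteq> - agree_upto z n" if "w \<notin> agree_upto z n" for w
    using that by (intro exI [of _ n]) (auto simp: agree_upto_def)
  then show ?thesis
    unfolding closed_def open_nat_fun_iff by blast
qed

lemma clopen_cylinder: "open (cylinder k)" "closed (cylinder k)"
  by (simp_all add: cylinder_def Let_def closed_agree_upto)

text \<open>Splitting a node has to be a choice among countably many alternatives, so the Hausdorff
  property is put into one sequence of disjoint pairs of basic open sets. The empty set joins the
  basis so that there is always a pair to enumerate.\<close>

lemma second_countable_separating_pairs:
  assumes "second_countable T" "Hausdorff_space T"
  obtains P Q :: "nat \<Rightarrow> 'a set"
  where "\<And>n. openin T (P n)" "\<And>n. openin T (Q n)" "\<And>n. P n \<inter> Q n = {}"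
    "\<And>x x'. x \<in> topspace T \<Longrightarrow> x' \<in> topspace T \<Longrightarrow> x \<noteq> x' \<Longrightarrow> \<exists>n. x \<in> P n \<and> x' \<in> Q n"
proof -
  obtain \<B> where \<B>: "countable \<B>" "\<forall>V\<in>\<B>. openin T V"
    "\<forall>U x. openin T U \<and> x \<in> U \<longrightarrow> (\<exists>V\<in>\<B>. x \<in> V \<and> V \<subseteq> U)"
    using assms(1) unfolding second_countable_def by blast
  define K where "K = {(U, V). U \<in> insert {} \<B> \<and> V \<in> insert {} \<B> \<and> U \<inter> V = {}}"
  have "K \<subseteq> insert {} \<B> \<times> insert {} \<B>"
    by (auto simp: K_def)
  then have "countable K"
    using \<B>(1) by (meson countable_SIGMA countable_insert countable_subset)
  have "({}, {}) \<in> K"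
    by (simp add: K_def)
  then have "K \<noteq> {}" by blast
  define P Q where "P n = fst (from_nat_into K n)" and "Q n = snd (from_nat_into K n)" for n
  have K: "(P n, Q n) \<in> K" for n
    using from_nat_into [OF \<open>K \<noteq> {}\<close>] by (simp add: P_def Q_def)
  show thesis
  proof
    fix n
    have "P n \<in> insert {} \<B>" "Q n \<in> insert {} \<B>" "P n \<inter> Q n = {}"
      using K [of n] unfolding K_def by simp_all
    then show "openin T (P n)" "openin T (Q n)" "P n \<inter> Q n = {}"
      using \<B>(2) by auto
  next
    fix x x' assume "x \<in> topspace T" "x' \<in> topspace T" "x \<noteq> x'"
    then obtain U V where UV: "openin T U" "openin T V" "x \<in> U" "x' \<in> V" "disjnt U V"
      using assms(2) unfolding Hausdorff_space_def by metis
    obtain U' where U': "U' \<in> \<B>" "x \<in> U'" "U' \<subseteq> U"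
      using \<B>(3) UV by blast
    obtain V' where V': "V' \<in> \<B>" "x' \<in> V'" "V' \<subseteq> V"
      using \<B>(3) UV by blast
    have "(U', V') \<in> K"
      using U' V' UV(5) by (auto simp: K_def disjnt_iff)
    then obtain n where "from_nat_into K n = (U', V')"
      using from_nat_into_surj [OF \<open>countable K\<close>] by blast
    then show "\<exists>n. x \<in> P n \<and> x' \<in> Q n"
      using U' V' by (intro exI [of _ n]) (simp add: P_def Q_def)
  qed
qed

context polish_borel_map
begin

text \<open>In the Cantor scheme, the node \<open>i < N\<close> has the children \<open>i\<close> and \<open>N + i\<close> at the next level.\<close>

lemma large_split_all:
  fixes N :: nat and p :: "(nat \<Rightarrow> nat) \<Rightarrow> 'x"
  assumes p: "continuous_map euclidean T p"
    and L: "large {..<N} (\<lambda>i. p ` R i)" and R: "\<And>i. i < N \<Longrightarrow> open (R i)"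
  shows "\<exists>R'. large {..<N + N} (\<lambda>i. p ` R' i) \<and> (\<forall>i < N + N. open (R' i)) \<and>
     (\<forall>i<N. R' i \<subseteq> R i \<and> R' (N + i) \<subseteq> R i \<and> p ` R' i \<inter> p ` R' (N + i) = {})"
proof -
  obtain P Q :: "nat \<Rightarrow> 'x set"
  where P: "\<And>n. openin T (P n)" and Q: "\<And>n. openin T (Q n)" and PQ: "\<And>n. P n \<inter> Q n = {}"
    and sep: "\<And>x x'. x \<in> topspace T \<Longrightarrow> x' \<in> topspace T \<Longrightarrow> x \<noteq> x' \<Longrightarrow> \<exists>n. x \<in> P n \<and> x' \<in> Q n"
    using second_countable_separating_pairs polish polish_top_Hausdorff [OF polish]
    unfolding polish_top_def by metis
  have an: "analytic_in T (p ` S)" if "open S" for S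
    by (rule analytic_in_image [OF analytic_in_open [OF polish_top_nat_fun] p]) (use that in simp)
  \<comment> \<open>The nodes are split one at a time: after \<open>m\<close> splits the family has
    gained the indices \<open>N, ..., N + m - 1\<close>, and largeness is carried through for all
    indices jointly.\<close>
  have "\<exists>R'. large {..<N + m} (\<lambda>i. p ` R' i) \<and> (\<forall>i < N + m. open (R' i)) \<and> (\<forall>i<N. R' i \<subseteq> R i) \<and>
     (\<forall>i<m. R' (N + i) \<subseteq> R i \<and> p ` R' i \<inter> p ` R' (N + i) = {})" if "m \<le> N" for m
    using that
  proof (induction m)
    case 0
    then show ?case
      using L R by (intro exI [of _ R]) auto
  next
    case (Suc m)
    then obtain R' where R': "large {..<N + m} (\<lambda>i. p ` R' i)" "\<And>i. i < N + m \<Longrightarrow> open (R' i)"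
      "\<And>i. i < N \<Longrightarrow> R' i \<subseteq> R i"
      "\<And>i. i < m \<Longrightarrow> R' (N + i) \<subseteq> R i \<and> p ` R' i \<inter> p ` R' (N + i) = {}"
      by auto
    have "\<exists>n. large (insert (N + m) {..<N + m})
        ((\<lambda>i. p ` R' i)(m := p ` R' m \<inter> P n, N + m := p ` R' m \<inter> Q n))"
      by (rule large_split [OF R'(1)]) (use Suc.prems R'(2) an sep in auto)
    then obtain n where n: "large (insert (N + m) {..<N + m})
        ((\<lambda>i. p ` R' i)(m := p ` R' m \<inter> P n, N + m := p ` R' m \<inter> Q n))" ..
    define R'' where "R'' = R'(m := R' m \<inter> p -` P n, N + m := R' m \<inter> p -` Q n)"
    have "insert (N + m) {..<N + m} = {..<N + Suc m}"
      by auto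
    moreover have "(\<lambda>i. p ` R' i)(m := p ` R' m \<inter> P n, N + m := p ` R' m \<inter> Q n) = (\<lambda>i. p ` R'' i)"
      by (auto simp: R''_def fun_eq_iff)
    ultimately have a1: "large {..<N + Suc m} (\<lambda>i. p ` R'' i)"
      using n by simp
    have a2: "\<forall>i < N + Suc m. open (R'' i)"
    proof (intro allI impI)
      fix i assume "i < N + Suc m"
      then have "i < N + m \<or> i = N + m" by auto
      moreover have "open (p -` P n)" "open (p -` Q n)" "open (R' m)"
        using p P Q R'(2) Suc.prems unfolding continuous_map_euclidean_iff by auto
      ultimately show "open (R'' i)"
        using R'(2) by (auto simp: R''_def)
    qed
    have a3: "\<forall>i<N. R'' i \<subseteq> R i"
    proof (intro allI impI)
      fix i assume "i < N"
      then show "R'' i \<subseteq> R i"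
        using R'(3) [of i] by (auto simp: R''_def)
    qed
    have a4: "R'' (N + i) \<subseteq> R i \<and> p ` R'' i \<inter> p ` R'' (N + i) = {}" if "i < Suc m" for i
    proof (cases "i = m")
      case True
      then show ?thesis
        using R'(3) [of m] PQ [of n] Suc.prems by (auto simp: R''_def)
    next
      case False
      then show ?thesis
        using R'(4) [of i] that Suc.prems by (simp add: R''_def)
    qed
    show ?case
      by (intro exI [of _ R''] conjI a1 a2 a3 allI impI) (simp_all add: a4)
  qed
  from this [OF order_refl] obtain R' where "large {..<N + N} (\<lambda>i. p ` R' i)"
    "\<forall>i < N + N. open (R' i)" "\<forall>i<N. R' i \<subseteq> R i"
    "\<forall>i<N. R' (N + i) \<subseteq> R i \<and> p ` R' i \<inter> p ` R' (N + i) = {}"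
    by (elim exE conjE)
  then show ?thesis
    by (intro exI [of _ R'] conjI allI impI) simp_all
qed

text \<open>Each node is covered by countably many cylinders inside it that fix the first
  \<open>n\<close> entries, and \<open>large_UN\<close> picks one of them, node after node. Fixing
  entries makes branches converge, and closedness keeps their limits in the nodes.\<close>

lemma large_refine_all:
  fixes N n :: nat and p :: "(nat \<Rightarrow> nat) \<Rightarrow> 'x"
  assumes L: "large {..<N} (\<lambda>i. p ` R i)" and R: "\<And>i. i < N \<Longrightarrow> open (R i)"
  shows "\<exists>R'. large {..<N} (\<lambda>i. p ` R' i) \<and>
     (\<forall>i<N. R' i \<subseteq> R i \<and> open (R' i) \<and> closed (R' i) \<and> (\<forall>w\<in>R' i. \<forall>w'\<in>R' i. \<forall>j<n. w j = w' j))"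
proof -
  define G where "G i k = (if cylinder k \<subseteq> R i \<and> (\<forall>w\<in>cylinder k. \<forall>w'\<in>cylinder k. \<forall>j<n. w j = w' j)
      then cylinder k else {})" for i k
  have cover: "p ` R i \<subseteq> (\<Union>k. p ` G i k)" if i: "i < N" for i
  proof
    fix x assume "x \<in> p ` R i"
    then obtain z where z: "x = p z" "z \<in> R i" by blast
    then obtain m where m: "agree_upto z m \<subseteq> R i"
      using R [OF i] unfolding open_nat_fun_iff by blast
    obtain k where k: "cylinder k = agree_upto z (max m n)"
      using cylinder_agree_upto by blast
    then have "cylinder k \<subseteq> R i"
      using m agree_upto_mono [of m "max m n" z] by auto
    moreover have "w j = w' j" if "w \<in> cylinder k" "w' \<in> cylinder k" "j < n" for w w' j
      using that unfolding k by (simp add: agree_upto_def)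
    ultimately have "G i k = cylinder k"
      unfolding G_def by auto
    then have "z \<in> G i k"
      by (simp add: k)
    then show "x \<in> (\<Union>k. p ` G i k)"
      unfolding z(1) by blast
  qed
  have "\<exists>R'. large {..<N} (\<lambda>i. p ` R' i) \<and> (\<forall>i<m. \<exists>k. R' i = G i k) \<and> (\<forall>i\<in>{m..<N}. R' i = R i)"
    if "m \<le> N" for m
    using that
  proof (induction m)
    case 0
    then show ?case
      using L by (intro exI [of _ R]) auto
  next
    case (Suc m)
    then obtain R' where R': "large {..<N} (\<lambda>i. p ` R' i)" "\<forall>i<m. \<exists>k. R' i = G i k"
      "\<forall>i\<in>{m..<N}. R' i = R i"
      by auto
    have "\<exists>k. large {..<N} ((\<lambda>i. p ` R' i)(m := p ` G m k))"
      by (rule large_UN [OF R'(1)]) (use Suc.prems R'(3) cover [of m] in auto)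
    then obtain k where k: "large {..<N} ((\<lambda>i. p ` R' i)(m := p ` G m k))" ..
    have "(\<lambda>i. p ` R' i)(m := p ` G m k) = (\<lambda>i. p ` (R'(m := G m k)) i)"
      by (auto simp: fun_eq_iff)
    then show ?case
      using k R'(2,3) by (intro exI [of _ "R'(m := G m k)"]) (auto simp: less_Suc_eq)
  qed
  from this [OF order_refl] obtain R'
    where R': "large {..<N} (\<lambda>i. p ` R' i)" "\<forall>i<N. \<exists>k. R' i = G i k"
    by blast
  have G: "G i k \<subseteq> R i \<and> open (G i k) \<and> closed (G i k) \<and> (\<forall>w\<in>G i k. \<forall>w'\<in>G i k. \<forall>j<n. w j = w' j)" for i k
    unfolding G_def using clopen_cylinder by simp
  have "R' i \<subseteq> R i \<and> open (R' i) \<and> closed (R' i) \<and> (\<forall>w\<in>R' i. \<forall>w'\<in>R' i. \<forall>j<n. w j = w' j)"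
    if i: "i < N" for i
  proof -
    obtain k where k: "R' i = G i k"
      using R'(2) i by blast
    show ?thesis
      unfolding k by (rule G)
  qed
  then show ?thesis
    by (intro exI [of _ R'] conjI R'(1) allI impI) simp_all
qed

end

text \<open>The position at level \<open>n\<close> of the branch \<open>S\<close> of the Cantor scheme, read in binary.\<close>

primrec branch :: "nat set \<Rightarrow> nat \<Rightarrow> nat" where
  "branch S 0 = 0"
| "branch S (Suc n) = (if n \<in> S then 2 ^ n + branch S n else branch S n)"

lemma branch_less: "branch S n < 2 ^ n"
  by (induction n) auto

lemma branch_cong: "(\<And>i. i < n \<Longrightarrow> i \<in> S \<longleftrightarrow> i \<in> S') \<Longrightarrow> branch S n = branch S' n"
  by (induction n) auto

lemma uncountable_nat_sets: "uncountable (UNIV :: nat set set)"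
proof
  assume "countable (UNIV :: nat set set)"
  then have "range (from_nat_into (UNIV :: nat set set)) = Pow UNIV"
    by (simp add: range_from_nat_into)
  then show False
    using Cantors_theorem [of "UNIV :: nat set"] by blast
qed

context polish_borel_map
begin

text \<open>Largeness gives each level one value \<open>y n\<close> that all its nodes attain. Along
  a branch the chosen parameters converge, so by continuity every limit point has the value
  \<open>lim y\<close>. Branches that first part at \<open>n\<close> end in siblings with disjoint
  images, so one fibre contains a copy of the power set of the naturals.\<close>

lemma large_imp_uncountable_fibre:
  fixes p :: "(nat \<Rightarrow> nat) \<Rightarrow> 'x"
  assumes p: "continuous_map euclidean T p" and fp: "continuous_on UNIV (\<lambda>z. f (p z))"
    and L: "large {..<1::nat} (\<lambda>i. range p)"
  shows "\<exists>y. uncountable {x \<in> topspace T. f x = y}"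
proof -
  let ?P = "\<lambda>(n :: nat) (R :: nat \<Rightarrow> (nat \<Rightarrow> nat) set). large {..<2^n} (\<lambda>i. p ` R i) \<and>
     (\<forall>i<2^n. open (R i) \<and> closed (R i) \<and> (\<forall>w\<in>R i. \<forall>w'\<in>R i. \<forall>j<n. w j = w' j))"
  let ?Q = "\<lambda>(n :: nat) (R :: nat \<Rightarrow> (nat \<Rightarrow> nat) set) (R' :: nat \<Rightarrow> (nat \<Rightarrow> nat) set).
     \<forall>i<2^n. R' i \<subseteq> R i \<and> R' (2^n + i) \<subseteq> R i \<and> p ` R' i \<inter> p ` R' (2^n + i) = {}"
  have "\<exists>R :: nat \<Rightarrow> nat \<Rightarrow> (nat \<Rightarrow> nat) set. \<forall>n. ?P n (R n) \<and> ?Q n (R n) (R (Suc n))"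
  proof (rule dependent_nat_choice)
    show "\<exists>R. ?P 0 R"
      using L by (intro exI [of _ "\<lambda>_. UNIV"]) simp
  next
    fix R :: "nat \<Rightarrow> (nat \<Rightarrow> nat) set" and n
    assume R: "?P n R"
    obtain R' where R': "large {..<2^n + 2^n} (\<lambda>i. p ` R' i)" "\<And>i. i < 2^n + 2^n \<Longrightarrow> open (R' i)"
      "\<And>i. i < 2^n \<Longrightarrow> R' i \<subseteq> R i \<and> R' (2^n + i) \<subseteq> R i \<and> p ` R' i \<inter> p ` R' (2^n + i) = {}"
      using large_split_all [OF p, of "2^n" R] R by blast
    obtain R'' where R'': "large {..<2^n + 2^n} (\<lambda>i. p ` R'' i)"
      "\<And>i. i < 2^n + 2^n \<Longrightarrow> R'' i \<subseteq> R' i \<and> open (R'' i) \<and> closed (R'' i) \<and>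
        (\<forall>w\<in>R'' i. \<forall>w'\<in>R'' i. \<forall>j<Suc n. w j = w' j)"
      using large_refine_all [OF R'(1,2), of "Suc n"] by blast
    have dbl: "(2::nat) ^ Suc n = 2^n + 2^n" by simp
    have "?Q n R R''"
    proof (intro allI impI)
      fix i :: nat assume i: "i < 2^n"
      then have "R'' i \<subseteq> R' i" "R'' (2^n + i) \<subseteq> R' (2^n + i)"
        using R''(2) [of i] R''(2) [of "2^n + i"] by auto
      then show "R'' i \<subseteq> R i \<and> R'' (2^n + i) \<subseteq> R i \<and> p ` R'' i \<inter> p ` R'' (2^n + i) = {}"
        using R'(3) [OF i] by blast
    qed
    moreover have "?P (Suc n) R''"
      using R'' unfolding dbl by blast
    ultimately show "\<exists>R''. ?P (Suc n) R'' \<and> ?Q n R R''"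
      by blast
  qed
  then obtain R :: "nat \<Rightarrow> nat \<Rightarrow> (nat \<Rightarrow> nat) set"
    where R: "\<forall>n. ?P n (R n) \<and> ?Q n (R n) (R (Suc n))" ..
  have "\<forall>n. \<exists>y. \<forall>i<2^n. \<exists>w \<in> R n i. f (p w) = y"
  proof
    fix n
    have "\<exists>y. \<forall>i\<in>{..<2^n}. \<exists>x \<in> p ` R n i - {}. f x = y"
      using R small_empty unfolding large_def by blast
    then show "\<exists>y. \<forall>i<2^n. \<exists>w \<in> R n i. f (p w) = y"
      by auto
  qed
  then obtain y where y: "\<forall>n. \<forall>i<2^n. \<exists>w \<in> R n i. f (p w) = y n"
    by (rule choice [THEN exE])
  then have "\<forall>S n. \<exists>w. w \<in> R n (branch S n) \<and> f (p w) = y n"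
    using branch_less by blast
  then obtain w where w: "\<And>S n. w S n \<in> R n (branch S n)" "\<And>S n. f (p (w S n)) = y n"
    by metis
  have step: "R (Suc n) (branch S (Suc n)) \<subseteq> R n (branch S n)" for S n
    using R branch_less [of S n] by simp
  have dec: "R (m + n) (branch S (m + n)) \<subseteq> R n (branch S n)" for S m n
    by (induction m) (use step in \<open>auto simp del: branch.simps\<close>)
  define z where "z S n = w S (Suc n) n" for S n
  have wz: "w S m n = z S n" if "n < m" for S m n
  proof -
    have "w S m \<in> R (Suc n) (branch S (Suc n))"
      using w(1) [of S m] dec [of "m - Suc n" "Suc n" S] that by auto
    moreover have "w S (Suc n) \<in> R (Suc n) (branch S (Suc n))"
      by (rule w)
    moreover have "\<forall>u\<in>R (Suc n) (branch S (Suc n)). \<forall>u'\<in>R (Suc n) (branch S (Suc n)). \<forall>j<Suc n. u j = u' j"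
      using R branch_less [of S "Suc n"] by blast
    ultimately show ?thesis
      unfolding z_def by blast
  qed
  have lim: "(\<lambda>n. w S n) \<longlonglongrightarrow> z S" for S
  proof (rule topological_tendstoI)
    fix U assume "open U" "z S \<in> U"
    then obtain n where n: "agree_upto (z S) n \<subseteq> U"
      unfolding open_nat_fun_iff by blast
    have "w S m \<in> U" if "n \<le> m" for m
      using n wz [of _ m S] that by (auto simp: agree_upto_def)
    then show "\<forall>\<^sub>F n in sequentially. w S n \<in> U"
      unfolding eventually_sequentially by blast
  qed
  have zR: "z S \<in> R n (branch S n)" for S n
  proof (rule Lim_in_closed_set [OF _ _ _ lim])
    show "closed (R n (branch S n))"
      using R branch_less [of S n] by blast
    have "w S m \<in> R n (branch S n)" if "n \<le> m" for m
      using w(1) [of S m] dec [of "m - n" n S] that by auto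
    then show "\<forall>\<^sub>F m in sequentially. w S m \<in> R n (branch S n)"
      unfolding eventually_sequentially by blast
  qed simp
  have "y \<longlonglongrightarrow> f (p (z S))" for S
  proof -
    have "(\<lambda>n. f (p (w S n))) \<longlonglongrightarrow> f (p (z S))"
      by (rule continuous_on_tendsto_compose [OF fp lim]) auto
    then show ?thesis
      by (simp add: w(2))
  qed
  then have same: "f (p (z S)) = f (p (z {}))" for S
    using LIMSEQ_unique by blast
  have pT: "range p \<subseteq> topspace T"
    using p unfolding continuous_map_euclidean_iff by blast
  have "inj (\<lambda>S. p (z S))"
  proof (rule injI, rule ccontr)
    fix S S' assume eq: "p (z S) = p (z S')" and "S \<noteq> S'"
    then have "\<exists>n. (n \<in> S) \<noteq> (n \<in> S')" by blast
    define n where "n = (LEAST n. (n \<in> S) \<noteq> (n \<in> S'))"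
    have n: "(n \<in> S) \<noteq> (n \<in> S')"
      unfolding n_def by (rule LeastI_ex) fact
    have "(i \<in> S) = (i \<in> S')" if "i < n" for i
      using not_less_Least [of i "\<lambda>n. (n \<in> S) \<noteq> (n \<in> S')"] that by (auto simp: n_def)
    then have same_branch: "branch S n = branch S' n"
      by (rule branch_cong)
    have disj: "p ` R (Suc n) (branch S n) \<inter> p ` R (Suc n) (2^n + branch S n) = {}"
      using R branch_less [of S n] by blast
    have in1: "z S \<in> R (Suc n) (branch S (Suc n))" "z S' \<in> R (Suc n) (branch S' (Suc n))"
      by (rule zR)+
    show False
    proof (cases "n \<in> S")
      case True
      then have "z S \<in> R (Suc n) (2^n + branch S n)" "z S' \<in> R (Suc n) (branch S n)"
        using in1 n same_branch by simp_all
      then show False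
        using disj eq by (metis disjoint_iff imageI)
    next
      case False
      then have "z S \<in> R (Suc n) (branch S n)" "z S' \<in> R (Suc n) (2^n + branch S n)"
        using in1 n same_branch by simp_all
      then show False
        using disj eq by (metis disjoint_iff imageI)
    qed
  qed
  then have "uncountable (range (\<lambda>S. p (z S)))"
    using uncountable_nat_sets countable_image_inj_on by blast
  moreover have "range (\<lambda>S. p (z S)) \<subseteq> {x \<in> topspace T. f x = f (p (z {}))}"
    using same pT by blast
  ultimately show ?thesis
    using countable_subset by blast
qed

text \<open>The family with the single node \<open>range p\<close> is not large, and a small set
  witnessing this must cover the whole space.\<close>

lemma countable_to_one_imp_small:
  assumes "\<And>y. countable {x \<in> topspace T. f x = y}"
  shows "small (topspace T)"
proof (cases "topspace T = {}")
  case False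
  obtain p :: "(nat \<Rightarrow> nat) \<Rightarrow> 'x" where p: "continuous_map euclidean T p"
    "continuous_on UNIV (\<lambda>z. f (p z))" "range p = topspace T"
    using analytic_in_param [OF analytic_in_topspace [OF polish] False] by blast
  have "\<not> large {..<1::nat} (\<lambda>i. range p)"
    using large_imp_uncountable_fibre [OF p(1,2)] assms by blast
  then obtain B where B: "small B" "\<nexists>y. \<forall>i\<in>{..<1::nat}. \<exists>x \<in> range p - B. f x = y"
    unfolding large_def by blast
  then have "topspace T - B = {}"
    by (auto simp: p(3))
  moreover have "B \<subseteq> topspace T"
    using small_borel [OF B(1)] sigma_sets_into_sp [OF openin_subset_Pow] by blast
  ultimately show ?thesis
    using B(1) by (metis Diff_eq_empty_iff subset_antisym)
next
  case True
  show ?thesis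
    unfolding True by (rule small_empty)
qed

end

theorem Lusin_Novikov:
  fixes f :: "'x \<Rightarrow> 'y::polish_space"
  assumes X: "standard_borel X" and f: "f \<in> borel_measurable X"
    and "\<And>y. countable {x \<in> space X. f x = y}"
  obtains c :: "'x \<Rightarrow> nat" where "c \<in> measurable X (count_space UNIV)"
    "\<And>x x'. x \<in> space X \<Longrightarrow> x' \<in> space X \<Longrightarrow> f x = f x' \<Longrightarrow> c x = c x' \<Longrightarrow> x = x'"
proof -
  obtain T where T: "polish_top T" "topspace T = space X" "sets X = borel_sets_of T"
    using X unfolding standard_borel_def polish_top_def by metis
  interpret polish_borel_map T f
  proof
    fix U :: "'y set" assume "open U"
    then show "f -` U \<inter> topspace T \<in> borel_sets_of T"
      using measurable_sets [OF f, of U] by (simp add: T)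
  qed (rule T)
  have "small (topspace T)"
    by (rule countable_to_one_imp_small) (simp add: T assms(3))
  then obtain b :: "nat \<Rightarrow> 'x set"
    where b: "\<And>n. b n \<in> sets X" "\<And>n. inj_on f (b n)" "space X = (\<Union>n. b n)"
    unfolding small_def T by blast
  define c where "c x = (LEAST n. x \<in> b n)" for x
  have "c x = n \<longrightarrow> x \<in> b n" if "x \<in> space X" for x n
    using that unfolding c_def b(3) by (auto intro: LeastI)
  then have cb: "x \<in> b (c x)" if "x \<in> space X" for x
    using that by blast
  show thesis
  proof
    have "(\<lambda>x. x \<in> b n) \<in> measurable X (count_space UNIV)" for n
    proof -
      have "{x \<in> space X. x \<in> b n} = b n"
        using sets.sets_into_space [OF b(1) [of n]] by blast
      then show ?thesis
        using b(1) [of n] by (simp add: pred_def)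
    qed
    then show "c \<in> measurable X (count_space UNIV)"
      unfolding c_def by (rule measurable_Least)
    fix x x' assume "x \<in> space X" "x' \<in> space X" "f x = f x'" "c x = c x'"
    then show "x = x'"
      using cb [of x] cb [of x'] b(2) [of "c x"] by (metis inj_onD)
  qed
qed

section \<open>Asymptotic invariance and hyperfiniteness\<close>

text \<open>\<open>\<rho> n\<close> are asymptotically invariant functions and \<open>l n\<close> records how to recover \<open>\<rho> n\<close> from
  \<open>\<rho> (Suc n)\<close>; the finite approximations identify points that have merged before time \<open>n\<close> with
  all recorded labels at most \<open>n\<close>.\<close>

lemma hyperfinite_if_asymptotically_invariant:
  fixes \<rho> :: "nat \<Rightarrow> 'x \<Rightarrow> 's::{second_countable_topology,t2_space}"
    and l :: "nat \<Rightarrow> 'x \<Rightarrow> nat" and c :: "'x \<Rightarrow> nat"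
  assumes E: "borel_equiv_rel M E"
    and c [measurable]: "c \<in> measurable M (count_space UNIV)"
    and \<rho> [measurable]: "\<And>n. \<rho> n \<in> borel_measurable M"
    and l [measurable]: "\<And>n. l n \<in> measurable M (count_space UNIV)"
    and merge: "\<And>x y. (x, y) \<in> E \<Longrightarrow> \<exists>m. \<forall>k\<ge>m. \<rho> k x = \<rho> k y"
    and label: "\<And>k x y. x \<in> space M \<Longrightarrow> y \<in> space M \<Longrightarrow> \<rho> k x = \<rho> k y \<Longrightarrow>
      \<rho> (Suc k) x = \<rho> (Suc k) y \<Longrightarrow> l k x = l k y"
    and recover: "\<And>k x y. x \<in> space M \<Longrightarrow> y \<in> space M \<Longrightarrow> \<rho> (Suc k) x = \<rho> (Suc k) y \<Longrightarrow>
      l k x = l k y \<Longrightarrow> \<rho> k x = \<rho> k y"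
    and inj: "\<And>x y. x \<in> space M \<Longrightarrow> y \<in> space M \<Longrightarrow> \<rho> 0 x = \<rho> 0 y \<Longrightarrow> c x = c y \<Longrightarrow> x = y"
  shows "hyperfinite M E"
proof -
  have eqE: "equiv (space M) E" and mE: "E \<in> sets (M \<Otimes>\<^sub>M M)"
    using E by (auto simp: borel_equiv_rel_def)
  have EM: "x \<in> space M" "y \<in> space M" if "(x, y) \<in> E" for x y
    using that mE sets.sets_into_space [OF mE] by (auto simp: space_pair_measure)
  \<comment> \<open>\<open>m\<close> is a time from which the two sequences agree for good; only
    labels before \<open>m\<close> are bounded, since later ones may grow without bound.\<close>
  define G where "G n x y \<longleftrightarrow> (\<exists>m\<le>n. (\<forall>k\<ge>m. \<rho> k x = \<rho> k y) \<and> c x \<le> n \<and> c y \<le> n \<and>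
    (\<forall>k<m. l k x \<le> n \<and> l k y \<le> n))" for n x y
  \<comment> \<open>The diagonal has to be added, since \<open>G n x x\<close> fails while
    \<open>c x > n\<close>; it is written through \<open>\<rho> 0\<close> and \<open>c\<close> so
    that it is visibly Borel.\<close>
  define F where "F n = {(x, y) \<in> E. (\<rho> 0 x = \<rho> 0 y \<and> c x = c y) \<or> G n x y}" for n
  have F_iff: "(x, y) \<in> F n \<longleftrightarrow> (x, y) \<in> E \<and> (x = y \<or> G n x y)" for n x y
    unfolding F_def using inj EM by auto
  have G_trans: "G n x z" if "G n x y" "G n y z" "x \<in> space M" "y \<in> space M" "z \<in> space M" for n x y z
  proof -
    obtain m1 where m1: "m1 \<le> n" "\<forall>k\<ge>m1. \<rho> k x = \<rho> k y" "c x \<le> n" "\<forall>k<m1. l k x \<le> n \<and> l k y \<le> n"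
      using \<open>G n x y\<close> unfolding G_def by blast
    obtain m2 where m2: "m2 \<le> n" "\<forall>k\<ge>m2. \<rho> k y = \<rho> k z" "c z \<le> n" "\<forall>k<m2. l k y \<le> n \<and> l k z \<le> n"
      using \<open>G n y z\<close> unfolding G_def by blast
    \<comment> \<open>Between \<open>m1\<close> and \<open>max m1 m2\<close> the points
      \<open>x\<close> and \<open>y\<close> have already merged, so \<open>label\<close> carries the
      bound for \<open>y\<close> over to \<open>x\<close>.\<close>
    have x: "l k x \<le> n" if "k < max m1 m2" for k
    proof (cases "k < m1")
      case False
      then have "l k x = l k y"
        using m1(2) \<open>x \<in> space M\<close> \<open>y \<in> space M\<close> by (intro label) auto
      then show ?thesis
        using m2(4) that False by auto
    qed (use m1 in auto)
    have z: "l k z \<le> n" if "k < max m1 m2" for k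
    proof (cases "k < m2")
      case False
      then have "l k y = l k z"
        using m2(2) \<open>z \<in> space M\<close> \<open>y \<in> space M\<close> by (intro label) auto
      moreover have "l k y \<le> n"
        using m1(4) that False by auto
      ultimately show ?thesis
        by simp
    qed (use m2 in auto)
    show ?thesis
      unfolding G_def
    proof (intro exI [of _ "max m1 m2"] conjI allI impI)
      show "\<rho> k x = \<rho> k z" if "k \<ge> max m1 m2" for k
        using m1(2) m2(2) that by simp
    qed (use m1 m2 x z in auto)
  qed
  have equivF: "equiv (space M) (F n)" for n
  proof (rule equivI)
    show "F n \<subseteq> space M \<times> space M"
      using EM by (auto simp: F_def)
    show "refl_on (space M) (F n)"
      using eqE by (auto simp: refl_on_def F_iff equiv_def)
    show "sym (F n)"
      using eqE unfolding equiv_def by (auto simp: sym_def F_iff G_def)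
    show "trans (F n)"
    proof (rule transI)
      fix x y z assume xy: "(x, y) \<in> F n" and yz: "(y, z) \<in> F n"
      then have "(x, z) \<in> E"
        using eqE by (auto simp: F_iff equiv_def elim: transE)
      moreover have "x = z \<or> G n x z"
        using xy yz G_trans [of n x y z] EM unfolding F_iff by blast
      ultimately show "(x, z) \<in> F n"
        by (simp add: F_iff)
    qed
  qed
  have measF: "F n \<in> sets (M \<Otimes>\<^sub>M M)" for n
  proof -
    have eq [measurable]: "Measurable.pred (M \<Otimes>\<^sub>M M) (\<lambda>p. \<rho> k (fst p) = \<rho> k (snd p))" for k
      unfolding pred_def by (rule measurable_equality_set) measurable
    have cnt: "Measurable.pred (M \<Otimes>\<^sub>M M) (\<lambda>p. Q (h (fst p)))" "Measurable.pred (M \<Otimes>\<^sub>M M) (\<lambda>p. Q (h (snd p)))"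
      if "h \<in> measurable M (count_space UNIV)" for h :: "'x \<Rightarrow> nat" and Q
      by (rule measurable_compose [OF measurable_compose [OF measurable_fst that]], simp)
        (rule measurable_compose [OF measurable_compose [OF measurable_snd that]], simp)
    have [measurable]: "Measurable.pred (M \<Otimes>\<^sub>M M) (\<lambda>p. c (fst p) = c (snd p))"
    proof -
      have "Measurable.pred (M \<Otimes>\<^sub>M M) (\<lambda>p. \<exists>i. c (snd p) = i \<and> c (fst p) = i)"
        by (intro pred_intros_countable pred_intros_logic cnt c)
      then show ?thesis
        by simp
    qed
    have [measurable]: "Measurable.pred (M \<Otimes>\<^sub>M M) (\<lambda>p. G n (fst p) (snd p))"
      unfolding G_def by (intro pred_intros_countable_bounded pred_intros_countable pred_intros_logic cnt c l eq) auto
    have "Measurable.pred (M \<Otimes>\<^sub>M M) (\<lambda>p. (\<rho> 0 (fst p) = \<rho> 0 (snd p) \<and> c (fst p) = c (snd p)) \<or> G n (fst p) (snd p))"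
      by measurable
    then have "{p \<in> space (M \<Otimes>\<^sub>M M). (\<rho> 0 (fst p) = \<rho> 0 (snd p) \<and> c (fst p) = c (snd p)) \<or> G n (fst p) (snd p)}
        \<in> sets (M \<Otimes>\<^sub>M M)"
      unfolding pred_def .
    then have "E \<inter> {p \<in> space (M \<Otimes>\<^sub>M M). (\<rho> 0 (fst p) = \<rho> 0 (snd p) \<and> c (fst p) = c (snd p)) \<or> G n (fst p) (snd p)}
        \<in> sets (M \<Otimes>\<^sub>M M)"
      using mE by (rule sets.Int [rotated])
    moreover have "E \<inter> {p \<in> space (M \<Otimes>\<^sub>M M). (\<rho> 0 (fst p) = \<rho> 0 (snd p) \<and> c (fst p) = c (snd p)) \<or> G n (fst p) (snd p)} = F n"
      using EM by (auto simp: F_def space_pair_measure)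
    ultimately show ?thesis
      by simp
  qed
  \<comment> \<open>Going back from time \<open>m + 1\<close> to \<open>m\<close> costs one label
    with at most \<open>n + 1\<close> values; at time 0 the bound on \<open>c\<close> leaves
    finitely many points.\<close>
  have fin: "finite {y \<in> space M. \<rho> m y = s \<and> (\<forall>k<m. l k y \<le> n) \<and> c y \<le> n}" for m n s
  proof (induction m arbitrary: s)
    case 0
    have "inj_on c {y \<in> space M. \<rho> 0 y = s \<and> (\<forall>k<0. l k y \<le> n) \<and> c y \<le> n}"
      by (intro inj_onI inj) auto
    moreover have "c ` {y \<in> space M. \<rho> 0 y = s \<and> (\<forall>k<0. l k y \<le> n) \<and> c y \<le> n} \<subseteq> {..n}"
      by auto
    ultimately show ?case
      using finite_imageD finite_subset by blast
  next
    case (Suc m)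
    have "finite {y \<in> space M. \<rho> (Suc m) y = s \<and> (\<forall>k<m. l k y \<le> n) \<and> c y \<le> n \<and> l m y = j}" (is "finite ?Y") for j
    proof (cases "?Y = {}")
      case False
      then obtain y0 where y0: "y0 \<in> ?Y" by blast
      have "?Y \<subseteq> {y \<in> space M. \<rho> m y = \<rho> m y0 \<and> (\<forall>k<m. l k y \<le> n) \<and> c y \<le> n}"
        using y0 by (auto intro!: recover)
      then show ?thesis
        using Suc finite_subset by blast
    next
      case True
      show ?thesis
        unfolding True by simp
    qed
    then have "finite (\<Union>j\<le>n. {y \<in> space M. \<rho> (Suc m) y = s \<and> (\<forall>k<m. l k y \<le> n) \<and> c y \<le> n \<and> l m y = j})"
      by blast
    then show ?case
      by (rule finite_subset [rotated]) auto
  qed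
  have "finite_rel M (F n)" for n
    unfolding finite_rel_def quotient_def
  proof safe
    fix x assume x: "x \<in> space M"
    have "F n `` {x} \<subseteq> insert x (\<Union>m\<le>n. {y \<in> space M. \<rho> m y = \<rho> m x \<and> (\<forall>k<m. l k y \<le> n) \<and> c y \<le> n})"
    proof
      fix y assume "y \<in> F n `` {x}"
      then have xy: "(x, y) \<in> E" "x = y \<or> G n x y"
        by (auto simp: F_iff)
      show "y \<in> insert x (\<Union>m\<le>n. {y \<in> space M. \<rho> m y = \<rho> m x \<and> (\<forall>k<m. l k y \<le> n) \<and> c y \<le> n})"
      proof (cases "x = y")
        case False
        then obtain m where "m \<le> n" "\<forall>k\<ge>m. \<rho> k x = \<rho> k y" "c y \<le> n" "\<forall>k<m. l k y \<le> n"
          using xy(2) unfolding G_def by blast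
        then have "y \<in> {y \<in> space M. \<rho> m y = \<rho> m x \<and> (\<forall>k<m. l k y \<le> n) \<and> c y \<le> n}"
          using EM(2) [OF xy(1)] by simp
        with \<open>m \<le> n\<close> show ?thesis
          by blast
      qed simp
    qed
    then show "finite (F n `` {x})"
      by (rule finite_subset) (simp add: fin)
  qed
  moreover have "incseq F"
  proof (rule monoI)
    fix n n' :: nat assume "n \<le> n'"
    then have "G n x y \<Longrightarrow> G n' x y" for x y
      unfolding G_def by (meson order_trans)
    then show "F n \<subseteq> F n'"
      by (auto simp: F_def)
  qed
  moreover have "E = (\<Union>n. F n)"
  proof
    show "E \<subseteq> (\<Union>n. F n)"
    proof safe
      fix x y assume xy: "(x, y) \<in> E"
      then obtain m where m: "\<forall>k\<ge>m. \<rho> k x = \<rho> k y"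
        using merge by blast
      define n where "n = m + c x + c y + (\<Sum>k<m. l k x + l k y)"
      have "l k x \<le> n \<and> l k y \<le> n" if "k < m" for k
        using member_le_sum [of k "{..<m}" "\<lambda>k. l k x + l k y"] that by (simp add: n_def)
      then have "G n x y"
        unfolding G_def using m by (intro exI [of _ m]) (auto simp: n_def)
      then show "(x, y) \<in> (\<Union>n. F n)"
        using xy F_iff by blast
    qed
  qed (auto simp: F_def)
  ultimately show ?thesis
    unfolding hyperfinite_def borel_equiv_rel_def
    using eqE mE equivF measF by blast
qed

section \<open>Integral affine maps\<close>

text \<open>The sextuple \<open>(a, b, c, d, e, f)\<close> stands for the map \<open>w \<mapsto> ((a, b), (c, d)) w + (e, f)\<close>.
  A state \<open>(p, q, x, y)\<close> consists of a point \<open>(p, q)\<close>, transformed affinely, and a vector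
  \<open>(x, y)\<close>, transformed by the linear part only.\<close>

type_synonym aff = "int \<times> int \<times> int \<times> int \<times> int \<times> int"
type_synonym state = "real \<times> real \<times> real \<times> real"

definition aff_ok :: "aff \<Rightarrow> bool" where
  "aff_ok = (\<lambda>(a, b, c, d, e, f). a * d - b * c = 1)"

definition act :: "aff \<Rightarrow> state \<Rightarrow> state" where
  "act = (\<lambda>(a, b, c, d, e, f) (p, q, x, y).
     (a * p + b * q + e, c * p + d * q + f, a * x + b * y, c * x + d * y))"

definition aff_comp :: "aff \<Rightarrow> aff \<Rightarrow> aff" where
  "aff_comp = (\<lambda>(a, b, c, d, e, f) (a', b', c', d', e', f').
     (a * a' + b * c', a * b' + b * d', c * a' + d * c', c * b' + d * d',
      a * e' + b * f' + e, c * e' + d * f' + f))"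

definition aff_inv :: "aff \<Rightarrow> aff" where
  "aff_inv = (\<lambda>(a, b, c, d, e, f). (d, - b, - c, a, b * f - d * e, c * e - a * f))"

lemma aff_ok_simp [simp]: "aff_ok (a, b, c, d, e, f) \<longleftrightarrow> a * d - b * c = 1"
  by (simp add: aff_ok_def)

lemma act_simp [simp]: "act (a, b, c, d, e, f) (p, q, x, y) =
     (a * p + b * q + e, c * p + d * q + f, a * x + b * y, c * x + d * y)"
  by (simp add: act_def)

lemma act_comp: "act (aff_comp g h) s = act g (act h s)"
  by (cases g; cases h; cases s) (simp add: aff_comp_def algebra_simps)

lemma aff_ok_comp: "aff_ok g \<Longrightarrow> aff_ok h \<Longrightarrow> aff_ok (aff_comp g h)"
proof -
  obtain a b c d e f where g: "g = (a, b, c, d, e, f)" by (cases g)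
  obtain a' b' c' d' e' f' where h: "h = (a', b', c', d', e', f')" by (cases h)
  have "(a * a' + b * c') * (c * b' + d * d') - (a * b' + b * d') * (c * a' + d * c')
    = (a * d - b * c) * (a' * d' - b' * c')"
    by (simp add: algebra_simps)
  then show "aff_ok g \<Longrightarrow> aff_ok h \<Longrightarrow> aff_ok (aff_comp g h)"
    by (simp add: g h aff_comp_def)
qed

lemma aff_ok_inv: "aff_ok g \<Longrightarrow> aff_ok (aff_inv g)"
  by (cases g) (simp add: aff_inv_def algebra_simps)

lemma act_inv:
  assumes "aff_ok g"
  shows "act (aff_inv g) (act g s) = s"
proof -
  obtain a b c d e f where g: "g = (a, b, c, d, e, f)" by (cases g)
  obtain p q x y where s: "s = (p, q, x, y)" by (cases s)
  have "real_of_int (a * d - b * c) = 1"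
    using assms by (simp add: g)
  then have det: "real_of_int a * real_of_int d = 1 + real_of_int b * real_of_int c"
    by simp
  have "d * (a * p + b * q + e) - b * (c * p + d * q + f) + (b * f - d * e) = (a * d) * p - (b * c) * p"
    "a * (c * p + d * q + f) - c * (a * p + b * q + e) + (c * e - a * f) = (a * d) * q - (b * c) * q"
    "d * (a * x + b * y) - b * (c * x + d * y) = (a * d) * x - (b * c) * x"
    "a * (c * x + d * y) - c * (a * x + b * y) = (a * d) * y - (b * c) * y"
    by (simp_all add: algebra_simps)
  then show ?thesis
    by (simp add: g s aff_inv_def det algebra_simps)
qed

definition rdep :: "state \<Rightarrow> bool" where
  "rdep = (\<lambda>(p, q, x, y). \<exists>k l :: int. (k, l) \<noteq> (0, 0) \<and> real_of_int k * x + real_of_int l * y = 0)"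

lemma rdep_act_imp:
  assumes "aff_ok g" "rdep (act g s)"
  shows "rdep s"
proof -
  obtain a b c d e f where g: "g = (a, b, c, d, e, f)" by (cases g)
  obtain p q x y where s: "s = (p, q, x, y)" by (cases s)
  obtain k l :: int where kl: "(k, l) \<noteq> (0, 0)" "k * (a * x + b * y) + l * (c * x + d * y) = 0"
    using assms(2) by (auto simp: rdep_def g s)
  have det: "a * d = 1 + b * c"
    using assms(1) by (simp add: g)
  have "(k * a + l * c, k * b + l * d) \<noteq> (0, 0)"
  proof
    assume "(k * a + l * c, k * b + l * d) = (0, 0)"
    then have "(k * a + l * c) * d - (k * b + l * d) * c = 0" "(k * b + l * d) * a - (k * a + l * c) * b = 0"
      by simp_all
    moreover have "(k * a + l * c) * d - (k * b + l * d) * c = k * (a * d) - k * (b * c)"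
      "(k * b + l * d) * a - (k * a + l * c) * b = l * (a * d) - l * (b * c)"
      by (simp_all add: algebra_simps)
    ultimately have "k = 0" "l = 0"
      by (simp_all add: det algebra_simps)
    with kl show False by simp
  qed
  moreover have "(k * a + l * c) * x + (k * b + l * d) * y = 0"
    using kl(2) by (simp add: algebra_simps)
  ultimately show ?thesis
    unfolding rdep_def s prod.case
    by (intro exI [of _ "k * a + l * c"] exI [of _ "k * b + l * d"]) simp
qed

lemma rdep_act:
  assumes "aff_ok g"
  shows "rdep (act g s) \<longleftrightarrow> rdep s"
  using rdep_act_imp [OF assms, of s] rdep_act_imp [OF aff_ok_inv [OF assms], of "act g s"]
  by (auto simp: act_inv [OF assms])

lemma eventually_inverse_Suc_less: "0 < e \<Longrightarrow> \<forall>\<^sub>F n in sequentially. 1 / real (Suc n) < e"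
  using order_tendstoD(2) [OF LIMSEQ_inverse_real_of_nat, of e] by (simp add: inverse_eq_divide)

text \<open>The difference of the first rows has determinant 0 with \<open>(c, d)\<close>, hence is
  a multiple of it; the factor is the determinant of \<open>(a, b)\<close> and the difference, an
  integer.\<close>

lemma row_unique:
  fixes a b c d a' b' :: int
  assumes "a * d - b * c = 1" "a' * d - b' * c = 1"
  obtains k where "a' = a + k * c" "b' = b + k * d"
proof
  define k where "k = a * (b' - b) - b * (a' - a)"
  have w: "(a' - a) * d = (b' - b) * c"
    using assms by (simp add: algebra_simps)
  have "k * c = a * ((b' - b) * c) - b * c * (a' - a)"
    by (simp add: k_def algebra_simps)
  also have "\<dots> = a * ((a' - a) * d) - b * c * (a' - a)"
    by (simp only: w)
  also have "\<dots> = (a * d - b * c) * (a' - a)"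
    by (simp add: algebra_simps)
  finally show "a' = a + k * c"
    using assms by simp
  have "k * d = a * d * (b' - b) - b * ((a' - a) * d)"
    by (simp add: k_def algebra_simps)
  also have "\<dots> = a * d * (b' - b) - b * ((b' - b) * c)"
    by (simp only: w)
  also have "\<dots> = (a * d - b * c) * (b' - b)"
    by (simp add: algebra_simps)
  finally show "b' = b + k * d"
    using assms by simp
qed

lemma int_shift_eq:
  fixes e e' :: int and u :: real
  assumes "0 \<le> u + e" "u + e < 1" "0 \<le> u + e'" "u + e' < 1"
  shows "e = e'"
  using assms by linarith

subsection \<open>Vectors with irrational slope\<close>

text \<open>\<open>0 \<le> x < y\<close> selects the first row among the completions of a given
  second row, and the bounds on \<open>p\<close> and \<open>q\<close> select the translation. Only
  the second row, whose value is confined to a strip of width \<open>1 / (n + 1)\<close>, is left to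
  be chosen.\<close>

definition icand :: "nat \<Rightarrow> aff \<Rightarrow> state \<Rightarrow> bool" where
  "icand n h s \<longleftrightarrow> aff_ok h \<and> (case act h s of (p, q, x, y) \<Rightarrow>
     0 \<le> p \<and> p < 1 \<and> 0 \<le> q \<and> q < 1 \<and> 0 \<le> x \<and> x < y \<and> y < 1 / real (Suc n))"

definition low :: "aff \<Rightarrow> nat" where
  "low = (\<lambda>(a, b, c, d, e, f). nat \<bar>c\<bar>)"

definition imin :: "nat \<Rightarrow> aff \<Rightarrow> state \<Rightarrow> bool" where
  "imin n h s \<longleftrightarrow> icand n h s \<and> (\<forall>h'. icand n h' s \<longrightarrow> low h \<le> low h')"

lemma icand_comp: "aff_ok g \<Longrightarrow> icand n h (act g s) \<Longrightarrow> icand n (aff_comp h g) s"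
  by (simp add: icand_def act_comp aff_ok_comp)

lemma icand_comp_inv: "aff_ok g \<Longrightarrow> icand n h s \<Longrightarrow> icand n (aff_comp h (aff_inv g)) (act g s)"
  by (simp add: icand_comp aff_ok_inv act_inv)

text \<open>On the strip \<open>0 < c x + d y < \<epsilon>\<close> every integral functional of \<open>(c, d)\<close> is within a small error
  a fixed multiple of \<open>c\<close>, so minimising the absolute value of any of them selects the same pair.\<close>

lemma strip_minimum_unique:
  fixes c d c' d' g g' :: int and x y e \<kappa> :: real
  assumes y: "y \<noteq> 0" and \<kappa>: "\<kappa> = g' + g * x / y"
    and \<delta>: "0 < c * x + d * y" "c * x + d * y < e"
    and \<delta>': "0 < c' * x + d' * y" "c' * x + d' * y < e"
    and le: "\<bar>c\<bar> \<le> \<bar>c'\<bar>" and le': "\<bar>c' * g' - d' * g\<bar> \<le> \<bar>c * g' - d * g\<bar>"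
    and e: "2 * \<bar>g / y\<bar> * e < \<bar>\<kappa>\<bar>" "2 * e \<le> \<bar>y\<bar>"
  shows "c = c' \<and> d = d'"
proof -
  define t where "t = g / y"
  \<comment> \<open>On the strip \<open>d\<close> is nearly \<open>- c * x / y\<close>; substituting
    this into the functional leaves the factor \<kappa>, with an error proportional to
    \<open>c * x + d * y\<close>.\<close>
  have eq: "real_of_int (c * g' - d * g) = c * \<kappa> - t * (c * x + d * y)" for c d
    using y by (simp add: \<kappa> t_def field_simps)
  have "e > 0" using \<delta> by simp
  have small: "\<bar>t * u\<bar> \<le> \<bar>t\<bar> * e" if "0 < u" "u < e" for u
    using that by (simp add: abs_mult mult_left_mono)
  have "\<bar>c' * \<kappa>\<bar> \<le> \<bar>c' * \<kappa> - t * (c' * x + d' * y)\<bar> + \<bar>t\<bar> * e"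
    using small [OF \<delta>'] by linarith
  also have "\<bar>c' * \<kappa> - t * (c' * x + d' * y)\<bar> \<le> \<bar>c * \<kappa> - t * (c * x + d * y)\<bar>"
    using le' unfolding eq [symmetric] by linarith
  also have "\<dots> \<le> \<bar>c * \<kappa>\<bar> + \<bar>t\<bar> * e"
    using small [OF \<delta>] by linarith
  finally have "\<bar>c' * \<kappa>\<bar> < \<bar>c * \<kappa>\<bar> + \<bar>\<kappa>\<bar>"
    using e(1) unfolding t_def [symmetric] by linarith
  then have "\<bar>real_of_int c'\<bar> * \<bar>\<kappa>\<bar> < (\<bar>real_of_int c\<bar> + 1) * \<bar>\<kappa>\<bar>"
    by (simp add: abs_mult algebra_simps)
  then have "\<bar>real_of_int c'\<bar> < \<bar>real_of_int c\<bar> + 1"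
    by (rule mult_right_less_imp_less) simp
  then have "\<bar>c'\<bar> = \<bar>c\<bar>"
    using le by linarith
  \<comment> \<open>Equal signs: both values lie in an interval shorter than
    \<open>\<bar>y\<bar>\<close>, so \<open>d = d'\<close>. Opposite signs: the sum of the values is
    an integer multiple of \<open>y\<close>, positive and below \<open>2 * e\<close>, which is
    impossible.\<close>
  then consider "c' = c" | "c' = - c"
    by linarith
  then show ?thesis
  proof cases
    case 1
    have "\<bar>real_of_int (d - d') * y\<bar> < \<bar>y\<bar>"
      using \<delta> \<delta>' e(2) unfolding 1 by (simp add: algebra_simps)
    then have "\<bar>real_of_int (d - d')\<bar> < 1"
      using y by (simp add: abs_mult)
    then show ?thesis
      using 1 by linarith
  next
    case 2
    have pos: "0 < real_of_int (d + d') * y" and "real_of_int (d + d') * y < 2 * e"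
      using \<delta> \<delta>' unfolding 2 by (simp_all add: algebra_simps)
    then have "\<bar>real_of_int (d + d') * y\<bar> < \<bar>y\<bar>"
      using e(2) by linarith
    then have "\<bar>real_of_int (d + d')\<bar> < 1"
      using y by (simp add: abs_mult)
    then have "d + d' = 0"
      by linarith
    with pos show ?thesis by simp
  qed
qed

text \<open>Minimality of \<open>h'\<close> at \<open>act g s\<close>, seen from \<open>s\<close>,
  makes an integral functional of the second row of \<open>aff_comp h' g\<close> minimal in absolute
  value. For irrational slope its factor \<kappa> is nonzero, so for large \<open>n\<close> the
  strip lemma gives both maps the same second row, and the normalisation in \<open>icand\<close>
  does the rest.\<close>

lemma imin_eventually_unique:
  assumes irr: "\<not> rdep s" and g: "aff_ok g"
  shows "\<forall>\<^sub>F n in sequentially. \<forall>h h'. imin n h s \<longrightarrow> imin n h' (act g s) \<longrightarrow> act h s = act h' (act g s)"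
proof -
  obtain p q x y where s: "s = (p, q, x, y)" by (cases s)
  obtain g1 g2 g3 g4 g5 g6 where gg: "g = (g1, g2, g3, g4, g5, g6)" by (cases g)
  have no: "k * x + l * y \<noteq> 0" if "(k, l) \<noteq> (0, 0)" for k l :: int
    using irr that by (auto simp: rdep_def s)
  have y: "y \<noteq> 0"
    using no [of 0 1] by simp
  define \<kappa> where "\<kappa> = g4 + g3 * x / y"
  have "(g3, g4) \<noteq> (0, 0)"
    using g by (auto simp: gg)
  then have "\<kappa> \<noteq> 0"
    using no [of g3 g4] y by (simp add: \<kappa>_def field_simps)
  \<comment> \<open>The two thresholds yield the conditions of \<open>strip_minimum_unique\<close>;
    the summand 1 keeps the denominator positive when \<open>g3 = 0\<close>.\<close>
  then have "0 < \<bar>\<kappa>\<bar> / (2 * \<bar>g3 / y\<bar> + 1)" "0 < \<bar>y\<bar> / 2"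
    using y by (simp_all add: add_nonneg_pos)
  then have "\<forall>\<^sub>F n in sequentially. 1 / real (Suc n) < \<bar>\<kappa>\<bar> / (2 * \<bar>g3 / y\<bar> + 1) \<and> 1 / real (Suc n) < \<bar>y\<bar> / 2"
    by (intro eventually_conj eventually_inverse_Suc_less)
  then show ?thesis
  proof (rule eventually_mono, intro allI impI)
    fix n h h'
    assume n: "1 / real (Suc n) < \<bar>\<kappa>\<bar> / (2 * \<bar>g3 / y\<bar> + 1) \<and> 1 / real (Suc n) < \<bar>y\<bar> / 2"
      and h: "imin n h s" and h': "imin n h' (act g s)"
    define \<epsilon> where "\<epsilon> = 1 / real (Suc n)"
    have "\<epsilon> > 0" by (simp add: \<epsilon>_def)
    define t where "t = \<bar>g3 / y\<bar>"
    have "\<epsilon> < \<bar>\<kappa>\<bar> / (2 * t + 1)"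
      using n unfolding \<epsilon>_def t_def by blast
    moreover have "0 < 2 * t + 1"
      by (simp add: t_def add_nonneg_pos)
    ultimately have "\<epsilon> * (2 * t + 1) < \<bar>\<kappa>\<bar>"
      by (simp only: pos_less_divide_eq)
    then have "2 * t * \<epsilon> < \<bar>\<kappa>\<bar>"
      using \<open>\<epsilon> > 0\<close> by (simp add: algebra_simps)
    moreover have "2 * \<epsilon> \<le> \<bar>y\<bar>"
      using n unfolding \<epsilon>_def by linarith
    ultimately have e: "2 * \<bar>g3 / y\<bar> * \<epsilon> < \<bar>\<kappa>\<bar>" "2 * \<epsilon> \<le> \<bar>y\<bar>"
      unfolding t_def .
    have hc: "icand n h s" and hc': "icand n h' (act g s)"
      using h h' by (auto simp: imin_def)
    note H = icand_comp [OF g hc']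
    have le: "low h \<le> low (aff_comp h' g)" and le': "low h' \<le> low (aff_comp h (aff_inv g))"
      using h h' H icand_comp_inv [OF g hc] unfolding imin_def by blast+
    obtain a b c d e f where hh: "h = (a, b, c, d, e, f)" by (cases h)
    obtain r1 r2 r3 r4 r5 r6 where hh': "h' = (r1, r2, r3, r4, r5, r6)" by (cases h')
    obtain a' b' c' d' e' f' where HH: "aff_comp h' g = (a', b', c', d', e', f')" by (cases "aff_comp h' g")
    have c'd': "c' = r3 * g1 + r4 * g3" "d' = r3 * g2 + r4 * g4"
      using HH by (simp_all add: hh' gg aff_comp_def)
    \<comment> \<open>Undoing \<open>g\<close> recovers the minimised entry of \<open>h'\<close> as
      an integral functional of the second row seen from \<open>s\<close>.\<close>
    have "c' * g4 - d' * g3 = r3 * (g1 * g4 - g2 * g3)"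
      by (simp add: c'd' algebra_simps)
    then have r3: "c' * g4 - d' * g3 = r3"
      using g by (simp add: gg)
    have ok: "a * d - b * c = 1" "a' * d' - b' * c' = 1"
      using hc H by (simp_all add: icand_def hh HH)
    have B: "0 \<le> a * p + b * q + e" "a * p + b * q + e < 1" "0 \<le> c * p + d * q + f" "c * p + d * q + f < 1"
      "0 \<le> a * x + b * y" "a * x + b * y < c * x + d * y" "c * x + d * y < \<epsilon>"
      using hc by (simp_all add: icand_def hh s \<epsilon>_def)
    have B': "0 \<le> a' * p + b' * q + e'" "a' * p + b' * q + e' < 1" "0 \<le> c' * p + d' * q + f'" "c' * p + d' * q + f' < 1"
      "0 \<le> a' * x + b' * y" "a' * x + b' * y < c' * x + d' * y" "c' * x + d' * y < \<epsilon>"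
      using H by (simp_all add: icand_def HH s \<epsilon>_def)
    have cd: "c = c' \<and> d = d'"
    proof (rule strip_minimum_unique [OF y \<kappa>_def])
      show "\<bar>c\<bar> \<le> \<bar>c'\<bar>"
        using le by (simp add: low_def hh HH)
      have "\<bar>r3\<bar> \<le> \<bar>c * g4 - d * g3\<bar>"
        using le' by (simp add: low_def hh hh' gg aff_inv_def aff_comp_def)
      then show "\<bar>c' * g4 - d' * g3\<bar> \<le> \<bar>c * g4 - d * g3\<bar>"
        by (simp add: r3)
    qed (use B B' e in simp_all)
    then obtain k where k: "a' = a + k * c" "b' = b + k * d"
      using row_unique [OF ok(1)] ok(2) by metis
    have "a' * x + b' * y = a * x + b * y + k * (c * x + d * y)"
      by (simp add: k algebra_simps)
    then have "\<bar>k * (c * x + d * y)\<bar> < 1 * (c * x + d * y)"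
      using B B' cd by simp
    then have "\<bar>real_of_int k\<bar> * (c * x + d * y) < 1 * (c * x + d * y)"
      using B by (simp add: abs_mult)
    then have "\<bar>real_of_int k\<bar> < 1"
      by (rule mult_right_less_imp_less) (use B in linarith)
    then have "a' = a" "b' = b"
      using k by auto
    moreover have "e' = e" "f' = f"
      using int_shift_eq [of "a * p + b * q" e e'] int_shift_eq [of "c * p + d * q" f f'] B B' cd calculation
      by simp_all
    ultimately have "aff_comp h' g = h"
      using cd by (simp add: HH hh)
    then show "act h s = act h' (act g s)"
      using act_comp [of h' g s] by simp
  qed
qed

lemma coprime_complete_row:
  fixes c d :: int
  assumes "coprime c d"
  obtains a b where "a * d - b * c = 1"
proof -
  obtain u v where "u * c + v * d = 1"
    using bezout_int [of c d] assms by auto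
  then show thesis
    using that [of v "- u"] by simp
qed

lemma int_shift_ex: "\<exists>e :: int. 0 \<le> u + e \<and> u + e < (1::real)"
  by (intro exI [of _ "- \<lfloor>u\<rfloor>"]) (simp add: frac_lt_1 flip: frac_def)

text \<open>Irrational slope makes the integral combinations of \<open>x\<close> and
  \<open>y\<close> dense, so one of them lies in \<open>(0, \<epsilon>)\<close>. Dividing by the gcd
  of its coefficients keeps it there and makes the row primitive; a completing first row is then
  reduced modulo this row.\<close>

lemma icand_exists:
  assumes "\<not> rdep s"
  shows "\<exists>h. icand n h s"
proof -
  obtain p q x y where s: "s = (p, q, x, y)" by (cases s)
  have no: "k * x + l * y \<noteq> 0" if "(k, l) \<noteq> (0, 0)" for k l :: int
    using assms that by (auto simp: rdep_def s)
  have y: "y \<noteq> 0"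
    using no [of 0 1] by simp
  have irr: "x / y \<notin> \<rat>"
  proof
    assume "x / y \<in> \<rat>"
    then obtain m k :: int where "k > 0" "x / y = m / k"
      by (auto elim: Rats_cases')
    then have "k * x + (- m) * y = 0"
      using y by (simp add: field_simps)
    with no [of k "- m"] \<open>k > 0\<close> show False
      by simp
  qed
  define \<epsilon> where "\<epsilon> = 1 / real (Suc n)"
  have "\<epsilon> > 0" by (simp add: \<epsilon>_def)
  \<comment> \<open>Aiming at \<open>\<epsilon> / (2 * y)\<close> with error below
    \<open>\<epsilon> / (2 * \<bar>y\<bar>)\<close> places the combination in
    \<open>(0, \<epsilon>)\<close> after multiplication by \<open>y\<close>, whatever the sign of
    \<open>y\<close>.\<close>
  obtain m k :: int where mk: "\<bar>k * (x / y) - m - \<epsilon> / (2 * y)\<bar> < \<epsilon> / (2 * \<bar>y\<bar>)"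
  proof (rule sequence_of_fractional_parts_is_dense [OF irr])
    show "0 < \<epsilon> / (2 * \<bar>y\<bar>)"
      using \<open>\<epsilon> > 0\<close> y by simp
  qed blast
  have "k * x + (- m) * y - \<epsilon> / 2 = y * (k * (x / y) - m - \<epsilon> / (2 * y))"
    using y by (simp add: field_simps)
  then have "\<bar>k * x + (- m) * y - \<epsilon> / 2\<bar> = \<bar>y * (k * (x / y) - m - \<epsilon> / (2 * y))\<bar>"
    by (rule arg_cong)
  also have "\<dots> < \<bar>y\<bar> * (\<epsilon> / (2 * \<bar>y\<bar>))"
    unfolding abs_mult by (rule mult_strict_left_mono [OF mk]) (use y in simp)
  finally have "\<bar>k * x + (- m) * y - \<epsilon> / 2\<bar> < \<epsilon> / 2"
    using y by simp
  then have pos: "0 < k * x + (- m) * y" "k * x + (- m) * y < \<epsilon>"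
    by linarith+
  define G where "G = gcd k (- m)"
  have "k \<noteq> 0 \<or> - m \<noteq> 0"
    using pos by auto
  then have "G > 0"
    by (simp add: G_def)
  obtain c d where cd: "k = c * G" "- m = d * G" "coprime c d"
    using gcd_coprime_exists [of k "- m"] \<open>G > 0\<close> unfolding G_def by auto
  define \<delta> where "\<delta> = c * x + d * y"
  have G\<delta>: "k * x + (- m) * y = G * \<delta>"
    unfolding cd(1) cd(2) \<delta>_def by (simp add: algebra_simps)
  have \<delta>: "0 < \<delta>" "\<delta> < \<epsilon>"
  proof -
    show "0 < \<delta>"
      using pos(1) \<open>G > 0\<close> unfolding G\<delta> by (simp add: zero_less_mult_iff)
    then have "\<delta> \<le> G * \<delta>"
      using \<open>G > 0\<close> by simp
    then show "\<delta> < \<epsilon>"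
      using pos(2) unfolding G\<delta> by linarith
  qed
  obtain a0 b0 where ab0: "a0 * d - b0 * c = 1"
    using coprime_complete_row [OF cd(3)] .
  define j where "j = \<lfloor>(a0 * x + b0 * y) / \<delta>\<rfloor>"
  define a b where "a = a0 - j * c" and "b = b0 - j * d"
  have ab: "a * d - b * c = 1"
    using ab0 by (simp add: a_def b_def algebra_simps)
  have axby: "a * x + b * y = (a0 * x + b0 * y) - j * \<delta>"
    by (simp add: a_def b_def \<delta>_def algebra_simps)
  have "j \<le> (a0 * x + b0 * y) / \<delta>" "(a0 * x + b0 * y) / \<delta> < j + 1"
    unfolding j_def by linarith+
  then have row: "0 \<le> a * x + b * y" "a * x + b * y < c * x + d * y"
    using \<delta>(1) unfolding axby \<delta>_def [symmetric] by (simp_all add: field_simps)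
  obtain e :: int where e: "0 \<le> a * p + b * q + e" "a * p + b * q + e < 1"
    using int_shift_ex by blast
  obtain f :: int where f: "0 \<le> c * p + d * q + f" "c * p + d * q + f < 1"
    using int_shift_ex by blast
  have "icand n (a, b, c, d, e, f) s"
    using ab row e f \<delta> by (simp add: icand_def s \<delta>_def \<epsilon>_def)
  then show ?thesis ..
qed

lemma imin_exists: "\<not> rdep s \<Longrightarrow> \<exists>h. imin n h s"
  using icand_exists [of s n] ex_has_least_nat [of "\<lambda>h. icand n h s" _ low]
  unfolding imin_def by blast

subsection \<open>Vectors with rational slope\<close>

definition ncand :: "aff \<Rightarrow> state \<Rightarrow> bool" where
  "ncand h s \<longleftrightarrow> aff_ok h \<and> (case act h s of (p, q, x, y) \<Rightarrow>
     0 \<le> p \<and> p < 1 \<and> 0 \<le> q \<and> q < 1 \<and> y = 0 \<and> 0 < x)"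

lemma ncand_comp: "aff_ok g \<Longrightarrow> ncand h (act g s) \<Longrightarrow> ncand (aff_comp h g) s"
  by (simp add: ncand_def act_comp aff_ok_comp)

lemma ncand_comp_inv: "aff_ok g \<Longrightarrow> ncand h s \<Longrightarrow> ncand (aff_comp h (aff_inv g)) (act g s)"
  by (simp add: ncand_comp aff_ok_inv act_inv)

text \<open>A primitive integral row that annihilates the vector, completed to determinant 1, makes
  the vector horizontal; reversing both rows if necessary makes it point to the right.\<close>

lemma ncand_exists:
  assumes "rdep s" and nz: "snd (snd s) \<noteq> (0, 0)"
  shows "\<exists>h. ncand h s"
proof -
  obtain p q x y where s: "s = (p, q, x, y)" by (cases s)
  obtain k l :: int where kl: "(k, l) \<noteq> (0, 0)" "k * x + l * y = 0"
    using assms(1) by (auto simp: rdep_def s)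
  define G where "G = gcd k l"
  have "G > 0"
    using kl(1) by (auto simp: G_def)
  obtain c d where cd: "k = c * G" "l = d * G" "coprime c d"
    using gcd_coprime_exists [of k l] \<open>G > 0\<close> unfolding G_def by auto
  have "G * (c * x + d * y) = 0"
    using kl(2) unfolding cd(1) cd(2) by (simp add: algebra_simps)
  then have cxdy: "c * x + d * y = 0"
    using \<open>G > 0\<close> by simp
  obtain a b where ab: "a * d - b * c = 1"
    using coprime_complete_row [OF cd(3)] .
  have "a * x + b * y \<noteq> 0"
  proof
    assume *: "a * x + b * y = 0"
    have "real_of_int (a * d - b * c) * x = d * (a * x + b * y) - b * (c * x + d * y)"
      "real_of_int (a * d - b * c) * y = a * (c * x + d * y) - c * (a * x + b * y)"
      by (simp_all add: algebra_simps)
    then have "x = 0" "y = 0"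
      unfolding * cxdy ab by simp_all
    with nz show False
      by (simp add: s)
  qed
  then obtain \<sigma> :: int where \<sigma>: "\<sigma> * \<sigma> = 1" "0 < \<sigma> * (a * x + b * y)"
    by (metis linorder_neqE_linordered_idom mult_1 mult_minus1 mult_minus_left neg_0_less_iff_less
        of_int_1 of_int_minus minus_minus)
  obtain e :: int where e: "0 \<le> (\<sigma> * a) * p + (\<sigma> * b) * q + e" "(\<sigma> * a) * p + (\<sigma> * b) * q + e < (1::real)"
    using int_shift_ex by blast
  obtain f :: int where f: "0 \<le> (\<sigma> * c) * p + (\<sigma> * d) * q + f" "(\<sigma> * c) * p + (\<sigma> * d) * q + f < (1::real)"
    using int_shift_ex by blast
  have "(\<sigma> * a) * (\<sigma> * d) - (\<sigma> * b) * (\<sigma> * c) = (\<sigma> * \<sigma>) * (a * d - b * c)"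
    by (simp add: algebra_simps)
  then have "(\<sigma> * a) * (\<sigma> * d) - (\<sigma> * b) * (\<sigma> * c) = 1"
    by (simp add: \<sigma> ab)
  moreover have "(\<sigma> * c) * x + (\<sigma> * d) * y = \<sigma> * (c * x + d * y)" "(\<sigma> * a) * x + (\<sigma> * b) * y = \<sigma> * (a * x + b * y)"
    by (simp_all add: algebra_simps)
  ultimately have "ncand (\<sigma> * a, \<sigma> * b, \<sigma> * c, \<sigma> * d, e, f) s"
    using e f \<sigma>(2) unfolding ncand_def s act_simp prod.case aff_ok_simp of_int_mult
    by (simp add: cxdy)
  then show ?thesis ..
qed

text \<open>The normalising maps form one coset of the unipotent group: their linear parts differ by
  adding multiples of the second row to the first.\<close>

lemma ncand_coset:
  assumes h: "ncand (a, b, c, d, e, f) (p, q, x, y)" and H: "ncand (a', b', c', d', e', f') (p, q, x, y)"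
  obtains k where "a' = a + k * c" "b' = b + k * d" "c' = c" "d' = d" "f' = f"
    "e' = - \<lfloor>a' * p + b' * q\<rfloor>"
proof -
  have ok: "a * d - b * c = 1" "a' * d' - b' * c' = 1"
    and v: "c * x + d * y = 0" "0 < a * x + b * y" "c' * x + d' * y = 0" "0 < a' * x + b' * y"
    and E: "0 \<le> a' * p + b' * q + e'" "a' * p + b' * q + e' < 1"
    and F: "0 \<le> c * p + d * q + f" "c * p + d * q + f < 1" "0 \<le> c' * p + d' * q + f'" "c' * p + d' * q + f' < 1"
    using h H by (simp_all add: ncand_def)
  define x1 where "x1 = a * x + b * y"
  have det: "real_of_int a * real_of_int d - real_of_int b * real_of_int c = 1"
    using ok(1) by (metis of_int_1 of_int_diff of_int_mult)
  have "d * x1 = d * (a * x + b * y) - b * (c * x + d * y)"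
    unfolding v x1_def by simp
  also have "\<dots> = (real_of_int a * real_of_int d - real_of_int b * real_of_int c) * x"
    by (simp add: algebra_simps)
  finally have x: "x = d * x1"
    unfolding det by simp
  have "- c * x1 = a * (c * x + d * y) - c * (a * x + b * y)"
    unfolding v x1_def by simp
  also have "\<dots> = (real_of_int a * real_of_int d - real_of_int b * real_of_int c) * y"
    by (simp add: algebra_simps)
  finally have y: "y = - c * x1"
    unfolding det by simp
  have "x1 > 0"
    using v by (simp add: x1_def)
  have "real_of_int (c' * d - d' * c) * x1 = 0"
    using v(3) unfolding x y by (simp add: algebra_simps)
  then have "real_of_int (c' * d - d' * c) = 0"
    using \<open>x1 > 0\<close> by (simp only: mult_eq_0_iff) simp
  then have cd: "c' * d = d' * c"
    by (simp only: of_int_eq_0_iff)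
  have "0 < real_of_int (a' * d - b' * c) * x1"
    using v(4) unfolding x y by (simp add: algebra_simps)
  then have pos: "0 < a' * d - b' * c"
    using \<open>x1 > 0\<close> by (simp only: zero_less_mult_iff of_int_0_less_iff) auto
  \<comment> \<open>Both second rows annihilate the vector, so \<open>(c', d')\<close> is
    \<open>j\<close> times \<open>(c, d)\<close>. The determinant makes \<open>j\<close> a unit, and
    the positive first values exclude \<open>j = -1\<close>.\<close>
  define j where "j = a * d' - b * c'"
  have "j * c = a * (d' * c) - b * c' * c" "j * d = a * d' * d - b * (c' * d)"
    by (simp_all add: j_def algebra_simps)
  then have "j * c = a * (c' * d) - b * c' * c" "j * d = a * d' * d - b * (d' * c)"
    by (simp_all only: cd)
  then have "j * c = (a * d - b * c) * c'" "j * d = (a * d - b * c) * d'"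
    by (simp_all add: algebra_simps)
  then have j: "c' = j * c" "d' = j * d"
    by (simp_all add: ok)
  have "j * (a' * d - b' * c) = 1"
    using ok(2) by (simp add: j algebra_simps)
  then have "j = 1"
    using pos by (metis less_le_not_le linorder_not_le mult.commute mult_less_cancel_right1 pos_zmult_eq_1_iff)
  then have c'd': "c' = c" "d' = d"
    by (simp_all add: j)
  obtain k where k: "a' = a + k * c" "b' = b + k * d"
    using row_unique [OF ok(1)] ok(2) unfolding c'd' by metis
  have "f' = f"
    using int_shift_eq [of "c * p + d * q" f f'] F by (simp add: c'd')
  moreover have "e' = - \<lfloor>a' * p + b' * q\<rfloor>"
    using E by linarith
  ultimately show thesis
    using that k c'd' by blast
qed

text \<open>On the coset of normalising maps, \<open>row_dot\<close> increases strictly with the parameter of the coset.\<close>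

definition row_dot :: "aff \<Rightarrow> int" where
  "row_dot = (\<lambda>(a, b, c, d, e, f). a * c + b * d)"

text \<open>A single integer \<open>k\<close> describes the coset: adding \<open>k\<close> times the
  second row to the first adds \<open>k\<close> times its squared length \<open>R\<close> to
  \<open>row_dot\<close> and rotates the first coordinate by \<open>k * q0\<close>. With
  \<open>u = aff_inv g\<close> the same coset is counted from another point of the orbit, where the
  squared length is \<open>R'\<close>.\<close>

lemma ncand_param:
  assumes h0: "ncand h0 s" and u: "aff_ok u"
  obtains p0 q0 :: real and R R' :: int where "R > 0" "R' > 0"
    "\<And>H. ncand H s \<Longrightarrow> \<exists>k. row_dot H = row_dot h0 + k * R \<and>
       row_dot (aff_comp H u) = row_dot (aff_comp h0 u) + k * R' \<and>
       act H s = (frac (p0 + k * q0), snd (act h0 s))"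
    "\<And>k. \<exists>H. ncand H s \<and> row_dot H = row_dot h0 + k * R \<and>
       act H s = (frac (p0 + k * q0), snd (act h0 s))"
proof -
  obtain p q x y where s: "s = (p, q, x, y)" by (cases s)
  obtain a b c d e f where h: "h0 = (a, b, c, d, e, f)" by (cases h0)
  obtain u1 u2 u3 u4 u5 u6 where uu: "u = (u1, u2, u3, u4, u5, u6)" by (cases u)
  define R where "R = c * c + d * d"
  define R' where "R' = (c * u1 + d * u3) * (c * u1 + d * u3) + (c * u2 + d * u4) * (c * u2 + d * u4)"
  have ok: "a * d - b * c = 1"
    using h0 by (simp add: ncand_def h)
  have "aff_ok (aff_comp h0 u)"
    using h0 u by (simp add: ncand_def aff_ok_comp)
  then have ok': "(a * u1 + b * u3) * (c * u2 + d * u4) - (a * u2 + b * u4) * (c * u1 + d * u3) = 1"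
    by (simp add: h uu aff_comp_def)
  have "R > 0"
    unfolding R_def using ok by (simp only: sum_squares_gt_zero_iff) auto
  moreover have "R' > 0"
    unfolding R'_def using ok' by (simp only: sum_squares_gt_zero_iff) auto
  moreover have "\<exists>k. row_dot H = row_dot h0 + k * R \<and>
       row_dot (aff_comp H u) = row_dot (aff_comp h0 u) + k * R' \<and>
       act H s = (frac ((a * p + b * q) + k * (c * p + d * q)), snd (act h0 s))" if H: "ncand H s" for H
  proof -
    obtain a' b' c' d' e' f' where hh: "H = (a', b', c', d', e', f')" by (cases H)
    obtain k where k: "a' = a + k * c" "b' = b + k * d" "c' = c" "d' = d" "f' = f"
      "e' = - \<lfloor>a' * p + b' * q\<rfloor>"
      using ncand_coset [OF h0 [unfolded h s] H [unfolded hh s]] .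
    have "a' * p + b' * q = (a * p + b * q) + k * (c * p + d * q)"
      by (simp add: k algebra_simps)
    then have "a' * p + b' * q + e' = frac ((a * p + b * q) + k * (c * p + d * q))"
      unfolding k(6) frac_def by simp
    moreover have "a' * x + b' * y = a * x + b * y"
    proof -
      have "a' * x + b' * y = a * x + b * y + k * (c * x + d * y)"
        by (simp add: k algebra_simps)
      moreover have "c * x + d * y = 0"
        using h0 by (simp add: ncand_def h s)
      ultimately show ?thesis
        by simp
    qed
    ultimately have "act H s = (frac ((a * p + b * q) + k * (c * p + d * q)), snd (act h0 s))"
      using k(3-5) by (simp add: hh h s)
    moreover have "row_dot H = row_dot h0 + k * R"
      by (simp add: row_dot_def hh h k R_def algebra_simps)
    moreover have "row_dot (aff_comp H u) = row_dot (aff_comp h0 u) + k * R'"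
      by (simp add: row_dot_def aff_comp_def hh h uu k(1-4) R'_def algebra_simps)
    ultimately show ?thesis
      by blast
  qed
  moreover have "\<exists>H. ncand H s \<and> row_dot H = row_dot h0 + k * R \<and>
       act H s = (frac ((a * p + b * q) + k * (c * p + d * q)), snd (act h0 s))" for k
  proof -
    define H where "H = (a + k * c, b + k * d, c, d, - \<lfloor>(a * p + b * q) + k * (c * p + d * q)\<rfloor>, f)"
    have "c * x + d * y = 0"
      using h0 by (simp add: ncand_def h s)
    moreover have "(a + k * c) * x + (b + k * d) * y = a * x + b * y + k * (c * x + d * y)"
      "(a + k * c) * p + (b + k * d) * q + (- \<lfloor>(a * p + b * q) + k * (c * p + d * q)\<rfloor>)
       = frac ((a * p + b * q) + k * (c * p + d * q))"
      unfolding frac_def by (simp_all add: algebra_simps)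
    ultimately have "act H s = (frac ((a * p + b * q) + k * (c * p + d * q)), snd (act h0 s))"
      by (simp add: H_def h s)
    moreover have "ncand H s"
      using h0 ok unfolding ncand_def calculation
      by (simp add: h s H_def frac_lt_1 algebra_simps)
    moreover have "row_dot H = row_dot h0 + k * R"
      by (simp add: row_dot_def H_def h R_def algebra_simps)
    ultimately show ?thesis
      by blast
  qed
  ultimately show thesis
    by (rule that)
qed

text \<open>If the rotation is rational, the orbit of the first coordinate attains its minimum in the unit
  interval; otherwise take the first visit to \<open>(0, 1 / (n + 1))\<close>, which for large \<open>n\<close> does not depend on
  where the count starts.\<close>

definition attain :: "aff \<Rightarrow> state \<Rightarrow> bool" where
  "attain h s \<longleftrightarrow> ncand h s \<and> (\<forall>h'. ncand h' s \<longrightarrow> fst (act h s) \<le> fst (act h' s))"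

definition fcand :: "nat \<Rightarrow> aff \<Rightarrow> state \<Rightarrow> bool" where
  "fcand n h s \<longleftrightarrow> ncand h s \<and> 0 < fst (act h s) \<and> fst (act h s) < 1 / real (Suc n) \<and> 0 \<le> row_dot h"

definition fmin :: "nat \<Rightarrow> aff \<Rightarrow> state \<Rightarrow> bool" where
  "fmin n h s \<longleftrightarrow> fcand n h s \<and> (\<forall>h'. fcand n h' s \<longrightarrow> row_dot h \<le> row_dot h')"

text \<open>The case distinction is on attainment rather than on rationality of the rotation: it is
  invariant along the orbit by \<open>attain_ex_iff\<close>, and it also absorbs irrational
  rotations whose orbit passes through 0.\<close>

definition hit :: "nat \<Rightarrow> aff \<Rightarrow> state \<Rightarrow> bool" where
  "hit n h s \<longleftrightarrow> (if \<exists>h'. attain h' s then attain h s else fmin n h s)"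

lemma attain_comp:
  assumes g: "aff_ok g" and h: "attain h (act g s)"
  shows "attain (aff_comp h g) s"
  unfolding attain_def
proof (intro conjI allI impI)
  show "ncand (aff_comp h g) s"
    using h ncand_comp [OF g] by (simp add: attain_def)
  fix h' assume "ncand h' s"
  then have "fst (act h (act g s)) \<le> fst (act (aff_comp h' (aff_inv g)) (act g s))"
    using h ncand_comp_inv [OF g] unfolding attain_def by blast
  then show "fst (act (aff_comp h g) s) \<le> fst (act h' s)"
    by (simp add: act_comp act_inv [OF g])
qed

lemma attain_ex_iff:
  assumes g: "aff_ok g"
  shows "(\<exists>h. attain h (act g s)) \<longleftrightarrow> (\<exists>h. attain h s)"
proof
  assume "\<exists>h. attain h s"
  then obtain h where "attain h (act (aff_inv g) (act g s))"
    by (auto simp: act_inv [OF g])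
  then show "\<exists>h. attain h (act g s)"
    using attain_comp [OF aff_ok_inv [OF g]] by blast
qed (use attain_comp [OF g] in blast)

lemma aff_ok_one: "aff_ok (1, 0, 0, 1, 0, 0)"
  by simp

text \<open>Varying the parameter of the coset moves only the first coordinate of the image.\<close>

lemma ncand_eqI:
  assumes h: "ncand h s" and H: "ncand H s" and "fst (act h s) = fst (act H s)"
  shows "act h s = act H s"
proof (rule ncand_param [OF h aff_ok_one])
  fix p0 q0 :: real and R R' :: int
  assume *: "\<And>H. ncand H s \<Longrightarrow> \<exists>k. row_dot H = row_dot h + k * R \<and>
       row_dot (aff_comp H (1, 0, 0, 1, 0, 0)) = row_dot (aff_comp h (1, 0, 0, 1, 0, 0)) + k * R' \<and>
       act H s = (frac (p0 + k * q0), snd (act h s))"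
  from * [OF H] have "snd (act H s) = snd (act h s)"
    by force
  then show ?thesis
    using assms(3) by (simp add: prod_eq_iff)
qed

lemma attain_unique:
  assumes g: "aff_ok g" and h: "attain h s" and h': "attain h' (act g s)"
  shows "act h s = act h' (act g s)"
proof -
  note H = attain_comp [OF g h']
  have "fst (act h s) = fst (act (aff_comp h' g) s)"
    using h H unfolding attain_def by (meson order_antisym)
  then have "act h s = act (aff_comp h' g) s"
    using h H by (intro ncand_eqI) (auto simp: attain_def)
  then show ?thesis
    by (simp add: act_comp)
qed

text \<open>Counting from \<open>s\<close> and from \<open>act g s\<close> starts at different
  parameters, but outside a finite window both counts have the same sign. For large \<open>n\<close>
  the window contains no visit to the interval, so each first visit lies beyond it and competes in
  the other minimisation.\<close>

lemma fmin_eventually_unique: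
  assumes g: "aff_ok g"
  shows "\<forall>\<^sub>F n in sequentially. \<forall>h h'. fmin n h s \<longrightarrow> fmin n h' (act g s) \<longrightarrow> act h s = act h' (act g s)"
proof (cases "\<exists>h0. ncand h0 s")
  case True
  then obtain h0 where h0: "ncand h0 s" ..
  show ?thesis
  proof (rule ncand_param [OF h0 aff_ok_inv [OF g]])
    fix p0 q0 :: real and R R' :: int
    assume R: "R > 0" "R' > 0"
      and param: "\<And>H. ncand H s \<Longrightarrow> \<exists>k. row_dot H = row_dot h0 + k * R \<and>
       row_dot (aff_comp H (aff_inv g)) = row_dot (aff_comp h0 (aff_inv g)) + k * R' \<and>
       act H s = (frac (p0 + k * q0), snd (act h0 s))"
    define S0 S1 where "S0 = row_dot h0" and "S1 = row_dot (aff_comp h0 (aff_inv g))"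
    \<comment> \<open>Since \<open>R\<close> and \<open>R'\<close> are at least 1,
      \<open>\<bar>k\<bar> > K\<close> determines the signs of \<open>S0 + k * R\<close> and
      \<open>S1 + k * R'\<close>.\<close>
    define K where "K = \<bar>S0\<bar> + \<bar>S1\<bar>"
    have pos: "0 \<le> S0 + k * R" "0 \<le> S1 + k * R'" if "k > K" for k
    proof -
      have "k * 1 \<le> k * R" "k * 1 \<le> k * R'"
        using R that by (intro mult_left_mono; simp add: K_def)+
      then show "0 \<le> S0 + k * R" "0 \<le> S1 + k * R'"
        using that by (auto simp: K_def)
    qed
    have neg: "S0 + k * R < 0" "S1 + k * R' < 0" if "k < - K" for k
    proof -
      have "k * R \<le> k * 1" "k * R' \<le> k * 1"
        using R that by (intro mult_left_mono_neg; simp add: K_def)+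
      then show "S0 + k * R < 0" "S1 + k * R' < 0"
        using that by (auto simp: K_def)
    qed
    \<comment> \<open>The interval is open at 0, so each fixed \<open>k\<close> drops out for large
      \<open>n\<close> even if its point is 0 itself.\<close>
    have "\<forall>\<^sub>F n in sequentially. \<not> (0 < frac (p0 + k * q0) \<and> frac (p0 + k * q0) < 1 / real (Suc n))" for k :: int
    proof (cases "0 < frac (p0 + k * q0)")
      case True
      show ?thesis
        by (rule eventually_mono [OF eventually_inverse_Suc_less [OF True]]) simp
    qed simp
    then have "\<forall>\<^sub>F n in sequentially. \<forall>k\<in>{- K..K}. \<not> (0 < frac (p0 + k * q0) \<and> frac (p0 + k * q0) < 1 / real (Suc n))"
      by (intro eventually_ball_finite) auto
    then show ?thesis
    proof (rule eventually_mono, intro allI impI)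
      fix n h h'
      assume n: "\<forall>k\<in>{- K..K}. \<not> (0 < frac (p0 + k * q0) \<and> frac (p0 + k * q0) < 1 / real (Suc n))"
        and h: "fmin n h s" and h': "fmin n h' (act g s)"
      have hs: "ncand h s" "0 < fst (act h s)" "fst (act h s) < 1 / real (Suc n)" "0 \<le> row_dot h"
        using h by (auto simp: fmin_def fcand_def)
      have hs': "ncand h' (act g s)" "0 < fst (act h' (act g s))" "fst (act h' (act g s)) < 1 / real (Suc n)"
        "0 \<le> row_dot h'"
        using h' by (auto simp: fmin_def fcand_def)
      define H where "H = aff_comp h' g"
      have H: "ncand H s"
        unfolding H_def by (rule ncand_comp [OF g hs'(1)])
      have actH: "act H s = act h' (act g s)"
        by (simp add: H_def act_comp)
      have "row_dot (aff_comp H (aff_inv g)) = row_dot h'"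
      proof -
        obtain g1 g2 g3 g4 g5 g6 where gg: "g = (g1, g2, g3, g4, g5, g6)" by (cases g)
        obtain a b c d e f where hh: "h' = (a, b, c, d, e, f)" by (cases h')
        have det: "g1 * g4 - g2 * g3 = 1"
          using g by (simp add: gg)
        have "(a * g1 + b * g3) * g4 + (a * g2 + b * g4) * (- g3) = a * (g1 * g4 - g2 * g3)"
          "(a * g1 + b * g3) * (- g2) + (a * g2 + b * g4) * g1 = b * (g1 * g4 - g2 * g3)"
          "(c * g1 + d * g3) * g4 + (c * g2 + d * g4) * (- g3) = c * (g1 * g4 - g2 * g3)"
          "(c * g1 + d * g3) * (- g2) + (c * g2 + d * g4) * g1 = d * (g1 * g4 - g2 * g3)"
          by (simp_all add: algebra_simps)
        then show ?thesis
          unfolding row_dot_def H_def aff_comp_def aff_inv_def gg hh prod.case det by simp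
      qed
      then obtain k' where k': "row_dot H = S0 + k' * R" "row_dot h' = S1 + k' * R'"
        "act H s = (frac (p0 + k' * q0), snd (act h0 s))"
        using param [OF H] by (auto simp: S0_def S1_def)
      obtain k where k: "row_dot h = S0 + k * R" "row_dot (aff_comp h (aff_inv g)) = S1 + k * R'"
        "act h s = (frac (p0 + k * q0), snd (act h0 s))"
        using param [OF hs(1)] by (auto simp: S0_def S1_def)
      have "k > K"
        using n hs(2-4) neg(1) [of k] unfolding k by force
      have "k' > K"
        using n hs'(2-4) neg(2) [of k'] unfolding k'(2) actH [symmetric] k'(3) by force
      have "fcand n H s"
        unfolding fcand_def using H hs' pos(1) [OF \<open>k' > K\<close>] by (simp add: actH k'(1))
      then have "S0 + k * R \<le> S0 + k' * R"
        using h k(1) k'(1) unfolding fmin_def by metis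
      then have "k \<le> k'"
        using R by simp
      have "fcand n (aff_comp h (aff_inv g)) (act g s)"
        unfolding fcand_def using ncand_comp_inv [OF g hs(1)] hs pos(2) [OF \<open>k > K\<close>]
        by (simp add: act_comp act_inv [OF g] k(2))
      then have "S1 + k' * R' \<le> S1 + k * R'"
        using h' k(2) k'(2) unfolding fmin_def by metis
      then have "k' \<le> k"
        using R by simp
      then show "act h s = act h' (act g s)"
        using \<open>k \<le> k'\<close> k(3) k'(3) by (simp flip: actH)
    qed
  qed
next
  case False
  then show ?thesis
    by (simp add: fmin_def fcand_def)
qed

lemma hit_eventually_unique:
  assumes g: "aff_ok g"
  shows "\<forall>\<^sub>F n in sequentially. \<forall>h h'. hit n h s \<longrightarrow> hit n h' (act g s) \<longrightarrow> act h s = act h' (act g s)"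
proof (cases "\<exists>h. attain h s")
  case True
  then show ?thesis
    using attain_unique [OF g] attain_ex_iff [OF g, of s] by (simp add: hit_def)
next
  case False
  then show ?thesis
    using fmin_eventually_unique [OF g] attain_ex_iff [OF g, of s] by (simp add: hit_def)
qed

text \<open>A rotation by \<open>m / b\<close> takes only finitely many values in the unit interval,
  so its minimum is attained. Without a minimum the rotation is therefore irrational and visits
  every interval at arbitrarily late times.\<close>

lemma hit_exists:
  assumes "rdep s" and nz: "snd (snd s) \<noteq> (0, 0)"
  shows "\<exists>h. hit n h s"
proof (cases "\<exists>h. attain h s")
  case False
  obtain h0 where h0: "ncand h0 s"
    using ncand_exists [OF assms] ..
  show ?thesis
  proof (rule ncand_param [OF h0 aff_ok_one])
    fix p0 q0 :: real and R R' :: int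
    assume R: "R > 0"
      and p1: "\<And>H. ncand H s \<Longrightarrow> \<exists>k. row_dot H = row_dot h0 + k * R \<and>
       row_dot (aff_comp H (1, 0, 0, 1, 0, 0)) = row_dot (aff_comp h0 (1, 0, 0, 1, 0, 0)) + k * R' \<and>
       act H s = (frac (p0 + k * q0), snd (act h0 s))"
      and p2: "\<And>k. \<exists>H. ncand H s \<and> row_dot H = row_dot h0 + k * R \<and>
       act H s = (frac (p0 + k * q0), snd (act h0 s))"
    have "q0 \<notin> \<rat>"
    proof
      assume "q0 \<in> \<rat>"
      then obtain m b :: int where b: "b > 0" "q0 = m / b"
        by (auto elim: Rats_cases')
      define V where "V = (\<lambda>H. fst (act H s)) ` {H. ncand H s}"
      have "V \<subseteq> (\<lambda>j. p0 + of_int j / b) ` {\<lfloor>- p0 * b\<rfloor>..\<lceil>(1 - p0) * b\<rceil>}"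
      proof
        fix v assume "v \<in> V"
        then obtain k :: int where v: "v = frac (p0 + k * q0)"
          using p1 by (auto simp: V_def) (metis fst_conv)
        define j where "j = k * m - \<lfloor>p0 + k * q0\<rfloor> * b"
        have vj: "v = p0 + j / b"
          using b by (simp add: v frac_def j_def field_simps)
        have "0 \<le> v" "v < 1"
          by (simp_all add: v frac_lt_1)
        then have "- p0 * b \<le> j" "j \<le> (1 - p0) * b"
          using b unfolding vj by (simp_all add: field_simps)
        then have "j \<in> {\<lfloor>- p0 * b\<rfloor>..\<lceil>(1 - p0) * b\<rceil>}"
          by simp linarith
        then show "v \<in> (\<lambda>j. p0 + of_int j / b) ` {\<lfloor>- p0 * b\<rfloor>..\<lceil>(1 - p0) * b\<rceil>}"
          using vj by blast
      qed
      then have fin: "finite V"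
        by (rule finite_subset) simp
      moreover have "fst (act h0 s) \<in> V"
        unfolding V_def using h0 by blast
      then have "V \<noteq> {}"
        by blast
      ultimately have "Min V \<in> V"
        by (rule Min_in)
      then obtain h where "ncand h s" "fst (act h s) = Min V"
        by (auto simp: V_def)
      moreover have "Min V \<le> fst (act h' s)" if "ncand h' s" for h'
        using fin that by (intro Min_le) (auto simp: V_def)
      ultimately have "attain h s"
        by (simp add: attain_def)
      with False show False by blast
    qed
    \<comment> \<open>Starting the search at \<open>k0\<close> makes \<open>row_dot\<close>
      nonnegative at every later time, since \<open>R \<ge> 1\<close>.\<close>
    define k0 where "k0 = \<bar>row_dot h0\<bar>"
    define \<epsilon> where "\<epsilon> = 1 / real (Suc n)"
    have \<epsilon>: "0 < \<epsilon>" "\<epsilon> \<le> 1"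
      by (simp_all add: \<epsilon>_def)
    obtain m k :: int where mk: "0 < k" "\<bar>k * q0 - m - (\<epsilon> / 2 - p0 - k0 * q0)\<bar> < \<epsilon> / 2"
    proof (rule sequence_of_fractional_parts_is_dense [OF \<open>q0 \<notin> \<rat>\<close>])
      show "0 < \<epsilon> / 2"
        using \<epsilon> by simp
    qed blast
    define u where "u = p0 + of_int (k0 + k) * q0"
    have eq: "k * q0 - m - (\<epsilon> / 2 - p0 - k0 * q0) = u - m - \<epsilon> / 2"
      by (simp add: u_def algebra_simps)
    have "\<bar>u - m - \<epsilon> / 2\<bar> < \<epsilon> / 2"
      using mk(2) unfolding eq .
    then have um: "0 < u - m" "u - m < \<epsilon>"
      by linarith+
    then have "\<lfloor>u\<rfloor> = m"
      using \<epsilon> by linarith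
    then have frac: "frac u = u - m"
      by (simp add: frac_def)
    obtain H where H: "ncand H s" "row_dot H = row_dot h0 + (k0 + k) * R"
      "act H s = (frac u, snd (act h0 s))"
      using p2 unfolding u_def by blast
    have "(k0 + k) * 1 \<le> (k0 + k) * R"
      using R mk(1) by (intro mult_left_mono) (simp_all add: k0_def)
    then have "0 \<le> row_dot H"
      using H(2) mk(1) by (simp add: k0_def)
    then have "fcand n H s"
      using H um unfolding fcand_def frac \<epsilon>_def by simp
    then obtain h where h: "fcand n h s" "\<forall>h'. fcand n h' s \<longrightarrow> nat (row_dot h) \<le> nat (row_dot h')"
      using ex_has_least_nat [of "\<lambda>h. fcand n h s" H "\<lambda>h. nat (row_dot h)"] by blast
    have "row_dot h \<le> row_dot h'" if "fcand n h' s" for h'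
    proof -
      have "nat (row_dot h) \<le> nat (row_dot h')" "0 \<le> row_dot h'"
        using h(2) that unfolding fcand_def by blast+
      then show ?thesis by linarith
    qed
    then have "fmin n h s"
      using h(1) by (simp add: fmin_def)
    then have "hit n h s"
      unfolding hit_def by (simp only: False if_False)
    then show ?thesis ..
  qed
next
  case True
  then obtain h where "attain h s" ..
  then have "hit n h s"
    unfolding hit_def by (simp only: True if_True)
  then show ?thesis ..
qed

subsection \<open>Asymptotically invariant choice of normalising maps\<close>

definition good :: "nat \<Rightarrow> aff \<Rightarrow> state \<Rightarrow> bool" where
  "good n h s \<longleftrightarrow> (if rdep s then hit n h s else imin n h s)"

lemma good_ok: "good n h s \<Longrightarrow> aff_ok h"
  by (auto simp: good_def hit_def attain_def fmin_def fcand_def ncand_def imin_def icand_def split: if_splits)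

lemma good_exists:
  assumes "snd (snd s) \<noteq> (0, 0)"
  shows "\<exists>h. good n h s"
proof (cases "rdep s")
  case True
  then show ?thesis
    using hit_exists [OF True assms] by (simp only: good_def if_True)
next
  case False
  then show ?thesis
    using imin_exists [OF False] by (simp only: good_def if_False)
qed

lemma good_eventually_unique:
  assumes g: "aff_ok g"
  shows "\<forall>\<^sub>F n in sequentially. \<forall>h h'. good n h s \<longrightarrow> good n h' (act g s) \<longrightarrow> act h s = act h' (act g s)"
  using hit_eventually_unique [OF g, of s] imin_eventually_unique [OF _ g, of s]
  by (cases "rdep s") (simp_all add: good_def rdep_act [OF g])

section \<open>Measurability and the sequence of normal forms\<close>

lemma continuous_on_act: "continuous_on UNIV (act h)"
proof -
  obtain a b c d e f where h: "h = (a, b, c, d, e, f)" by (cases h)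
  have "act h = (\<lambda>s :: state. (a * fst s + b * fst (snd s) + e, c * fst s + d * fst (snd s) + f,
      a * fst (snd (snd s)) + b * snd (snd (snd s)), c * fst (snd (snd s)) + d * snd (snd (snd s))))"
    by (auto simp: h fun_eq_iff)
  then show ?thesis
    by (auto intro!: continuous_intros)
qed

lemma measurable_act [measurable]: "act h \<in> borel_measurable borel"
  by (rule borel_measurable_continuous_onI [OF continuous_on_act])

lemma measurable_act_components [measurable]:
  "(\<lambda>s. fst (act h s)) \<in> borel_measurable borel"
  "(\<lambda>s. fst (snd (act h s))) \<in> borel_measurable borel"
  "(\<lambda>s. fst (snd (snd (act h s)))) \<in> borel_measurable borel"
  "(\<lambda>s. snd (snd (snd (act h s)))) \<in> borel_measurable borel"
  by (intro borel_measurable_continuous_onI continuous_on_fst continuous_on_snd continuous_on_act)+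

lemma pred_rdep [measurable]: "Measurable.pred borel rdep"
proof -
  have eq: "rdep s \<longleftrightarrow> (\<exists>kl :: int \<times> int. kl \<noteq> (0, 0) \<and>
      real_of_int (fst kl) * fst (snd (snd (act (1, 0, 0, 1, 0, 0) s)))
      + real_of_int (snd kl) * snd (snd (snd (act (1, 0, 0, 1, 0, 0) s))) = 0)" for s
    by (cases s) (simp add: rdep_def)
  have "Measurable.pred borel (\<lambda>s. rdep s)"
    unfolding eq by measurable
  then show ?thesis .
qed

lemma pred_icand [measurable]: "Measurable.pred borel (icand n h)"
proof -
  have eq: "icand n h = (\<lambda>s. aff_ok h \<and> 0 \<le> fst (act h s) \<and> fst (act h s) < 1 \<and>
     0 \<le> fst (snd (act h s)) \<and> fst (snd (act h s)) < 1 \<and>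
     0 \<le> fst (snd (snd (act h s))) \<and> fst (snd (snd (act h s))) < snd (snd (snd (act h s))) \<and>
     snd (snd (snd (act h s))) < 1 / real (Suc n))"
    by (rule ext) (simp only: icand_def case_prod_beta)
  show ?thesis
    unfolding eq by measurable
qed

lemma pred_ncand [measurable]: "Measurable.pred borel (ncand h)"
proof -
  have eq: "ncand h = (\<lambda>s. aff_ok h \<and> 0 \<le> fst (act h s) \<and> fst (act h s) < 1 \<and>
     0 \<le> fst (snd (act h s)) \<and> fst (snd (act h s)) < 1 \<and>
     snd (snd (snd (act h s))) = 0 \<and> 0 < fst (snd (snd (act h s))))"
    by (rule ext) (simp only: ncand_def case_prod_beta)
  show ?thesis
    unfolding eq by measurable
qed

text \<open>All quantifiers range over the countable type \<open>aff\<close>, so existence and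
  minimality are countable Boolean combinations of Borel conditions.\<close>

lemma pred_good [measurable]: "Measurable.pred borel (good n h)"
  unfolding good_def [abs_def] hit_def attain_def fmin_def fcand_def imin_def by measurable

text \<open>The second disjunct supplies a default where no good map exists, so that
  \<open>pick\<close> always codes an element of the group and normal forms stay in the
  orbit.\<close>

definition pick :: "nat \<Rightarrow> state \<Rightarrow> nat" where
  "pick n s = (LEAST i. aff_ok (from_nat i) \<and> (good n (from_nat i) s \<or> \<not> (\<exists>h. good n h s)))"

lemma measurable_pick [measurable]: "pick n \<in> measurable borel (count_space UNIV)"
  unfolding pick_def [abs_def] by measurable

lemma pick: "aff_ok (from_nat (pick n s))" "\<exists>h. good n h s \<Longrightarrow> good n (from_nat (pick n s)) s"
proof -
  have "\<exists>h. aff_ok h \<and> (good n h s \<or> \<not> (\<exists>h. good n h s))"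
    using good_ok aff_ok_one by blast
  then have "\<exists>i. aff_ok (from_nat i) \<and> (good n (from_nat i) s \<or> \<not> (\<exists>h. good n h s))"
    by (metis from_nat_to_nat)
  then have "aff_ok (from_nat (pick n s)) \<and> (good n (from_nat (pick n s)) s \<or> \<not> (\<exists>h. good n h s))"
    unfolding pick_def by (rule LeastI_ex)
  then show "aff_ok (from_nat (pick n s))" "\<exists>h. good n h s \<Longrightarrow> good n (from_nat (pick n s)) s"
    by blast+
qed

text \<open>Stage 0 is the state itself: points with equal stage 0 lie in one fibre of \<phi>, where
  the label of \<open>Lusin_Novikov\<close> separates them.\<close>

primrec normal :: "nat \<Rightarrow> state \<Rightarrow> state" where
  "normal 0 s = s"
| "normal (Suc n) s = act (from_nat (pick n s)) s"

lemma measurable_normal [measurable]: "normal n \<in> borel_measurable borel"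
proof (cases n)
  case 0
  then have "normal n = (\<lambda>s. s)"
    by (simp add: fun_eq_iff)
  then show ?thesis by simp
next
  case (Suc m)
  have "(\<lambda>s. act (from_nat (pick m s)) s) \<in> borel_measurable borel"
    by (rule measurable_compose_countable [OF measurable_act measurable_pick])
  moreover have "normal n = (\<lambda>s. act (from_nat (pick m s)) s)"
    by (simp add: Suc fun_eq_iff)
  ultimately show ?thesis by simp
qed

lemma normal_in_orbit: "\<exists>h. aff_ok h \<and> normal n s = act h s"
proof (cases n)
  case 0
  have "s = act (1, 0, 0, 1, 0, 0) s"
    by (cases s) simp
  then show ?thesis
    using 0 aff_ok_one by (metis normal.simps(1))
next
  case (Suc m)
  then show ?thesis
    by (intro exI [of _ "from_nat (pick m s)"] conjI pick(1)) simp
qed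

lemma normal_eventually_invariant:
  assumes g: "aff_ok g" and nz: "snd (snd s) \<noteq> (0, 0)" "snd (snd (act g s)) \<noteq> (0, 0)"
  shows "\<exists>m. \<forall>k\<ge>m. normal k s = normal k (act g s)"
proof -
  obtain m where m: "\<And>n h h'. n \<ge> m \<Longrightarrow> good n h s \<Longrightarrow> good n h' (act g s) \<Longrightarrow> act h s = act h' (act g s)"
    using good_eventually_unique [OF g, of s] unfolding eventually_sequentially by blast
  have "normal k s = normal k (act g s)" if k: "k \<ge> Suc m" for k
  proof -
    obtain n where n: "k = Suc n" "n \<ge> m"
      using Suc_le_D [OF k] k by auto
    show ?thesis
      unfolding n(1) normal.simps
      by (rule m [OF n(2)]) (intro pick(2) good_exists nz)+
  qed
  then show ?thesis
    by blast
qed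

text \<open>The code depends only on two consecutive normal forms and leads back from the later to
  the earlier one; these are the two properties required of the labels for hyperfiniteness.\<close>

definition link :: "nat \<Rightarrow> state \<Rightarrow> nat" where
  "link n s = (LEAST i. aff_ok (from_nat i) \<and> act (from_nat i) (normal (Suc n) s) = normal n s)"

lemma measurable_link [measurable]: "link n \<in> measurable borel (count_space UNIV)"
proof -
  have [measurable]: "Measurable.pred borel (\<lambda>s. act (from_nat i) (normal (Suc n) s) = normal n s)" for i
  proof -
    have "(\<lambda>s. act (from_nat i) (normal (Suc n) s)) \<in> borel_measurable borel"
      by (rule measurable_compose [OF measurable_normal measurable_act])
    from measurable_equality_set [OF this measurable_normal [of n]] show ?thesis
      unfolding pred_def .
  qed
  show ?thesis
    unfolding link_def [abs_def] by measurable
qed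

lemma link: "act (from_nat (link n s)) (normal (Suc n) s) = normal n s"
proof -
  obtain g where g: "aff_ok g" "normal (Suc n) s = act g s"
    using normal_in_orbit by blast
  obtain h where h: "aff_ok h" "normal n s = act h s"
    using normal_in_orbit by blast
  have "aff_ok (aff_comp h (aff_inv g)) \<and> act (aff_comp h (aff_inv g)) (normal (Suc n) s) = normal n s"
    using g h by (simp add: aff_ok_comp aff_ok_inv act_comp act_inv del: normal.simps)
  then have "\<exists>i. aff_ok (from_nat i) \<and> act (from_nat i) (normal (Suc n) s) = normal n s"
    by (metis from_nat_to_nat)
  then have "aff_ok (from_nat (link n s)) \<and> act (from_nat (link n s)) (normal (Suc n) s) = normal n s"
    unfolding link_def by (rule LeastI_ex)
  then show ?thesis ..
qed

subsection \<open>The affine group\<close>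

definition aff_map :: "aff \<Rightarrow> real^2 \<Rightarrow> real^2" where
  "aff_map = (\<lambda>(a, b, c, d, e, f). int_affine_map (vector [vector [a, b], vector [c, d]]) (vector [e, f]))"

lemma int_affine_map_components:
  "int_affine_map A b w $ 1 = A $ 1 $ 1 * w $ 1 + A $ 1 $ 2 * w $ 2 + b $ 1"
  "int_affine_map A b w $ 2 = A $ 2 $ 1 * w $ 1 + A $ 2 $ 2 * w $ 2 + b $ 2"
  by (simp_all add: int_affine_map_def matrix_vector_mult_def sum_2)

lemma aff_map_components:
  "aff_map (a, b, c, d, e, f) w $ 1 = a * w $ 1 + b * w $ 2 + e"
  "aff_map (a, b, c, d, e, f) w $ 2 = c * w $ 1 + d * w $ 2 + f"
  by (simp_all add: aff_map_def int_affine_map_components)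

lemma int_affine_map_eq_aff_map:
  "int_affine_map A b = aff_map (A $ 1 $ 1, A $ 1 $ 2, A $ 2 $ 1, A $ 2 $ 2, b $ 1, b $ 2)"
  by (simp add: fun_eq_iff vec_eq_iff forall_2 int_affine_map_components aff_map_components)

lemma carrier_Z2_SL2Z: "carrier Z2_SL2Z = aff_map ` {g. aff_ok g}"
proof
  show "carrier Z2_SL2Z \<subseteq> aff_map ` {g. aff_ok g}"
    by (auto simp: Z2_SL2Z_def int_affine_map_eq_aff_map det_2)
  show "aff_map ` {g. aff_ok g} \<subseteq> carrier Z2_SL2Z"
  proof safe
    fix a b c d e f assume "aff_ok (a, b, c, d, e, f)"
    then have "det (vector [vector [a, b], vector [c, d]] :: int^2^2) = 1"
      by (simp add: det_2)
    then show "aff_map (a, b, c, d, e, f) \<in> carrier Z2_SL2Z"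
      unfolding Z2_SL2Z_def aff_map_def by auto
  qed
qed

definition state_of :: "real^2 \<Rightarrow> real^2 \<Rightarrow> state" where
  "state_of u w = (u $ 1, u $ 2, u $ 1 - w $ 1, u $ 2 - w $ 2)"

lemma state_of_aff_map: "state_of (aff_map g u) (aff_map g w) = act g (state_of u w)"
  by (cases g) (simp add: state_of_def aff_map_components algebra_simps)

lemma state_of_eq_iff: "state_of u w = state_of u' w' \<longleftrightarrow> u = u' \<and> w = w'"
  by (auto simp: state_of_def vec_eq_iff forall_2)

lemma state_of_nonzero: "snd (snd (state_of u w)) \<noteq> (0, 0) \<longleftrightarrow> u \<noteq> w"
  by (auto simp: state_of_def vec_eq_iff forall_2)

text \<open>A point is recovered from the state of the pair \<open>(w, w)\<close>, so the identity
  is inherited from \<open>act_comp\<close>.\<close>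

lemma aff_map_comp: "aff_map (aff_comp g h) = aff_map g \<circ> aff_map h"
proof
  fix w
  have "state_of (aff_map (aff_comp g h) w) (aff_map (aff_comp g h) w)
    = state_of ((aff_map g \<circ> aff_map h) w) ((aff_map g \<circ> aff_map h) w)"
    by (simp add: state_of_aff_map act_comp)
  then show "aff_map (aff_comp g h) w = (aff_map g \<circ> aff_map h) w"
    by (simp only: state_of_eq_iff)
qed

lemma aff_map_inv:
  assumes "aff_ok g"
  shows "aff_map (aff_inv g) (aff_map g w) = w"
proof -
  have "state_of (aff_map (aff_inv g) (aff_map g w)) (aff_map (aff_inv g) (aff_map g w)) = state_of w w"
    by (simp add: state_of_aff_map act_inv [OF assms])
  then show ?thesis
    by (simp only: state_of_eq_iff)
qed

lemma aff_map_one: "aff_map (1, 0, 0, 1, 0, 0) = id"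
  by (simp add: fun_eq_iff vec_eq_iff forall_2 aff_map_components)

lemma group_Z2_SL2Z: "group Z2_SL2Z"
proof (rule groupI)
  note simps = carrier_Z2_SL2Z
  show "x \<otimes>\<^bsub>Z2_SL2Z\<^esub> y \<in> carrier Z2_SL2Z" if "x \<in> carrier Z2_SL2Z" "y \<in> carrier Z2_SL2Z" for x y
    using that unfolding simps by (auto simp: Z2_SL2Z_def aff_ok_comp simp flip: aff_map_comp)
  show "\<one>\<^bsub>Z2_SL2Z\<^esub> \<in> carrier Z2_SL2Z"
  proof -
    have "\<one>\<^bsub>Z2_SL2Z\<^esub> = aff_map (1, 0, 0, 1, 0, 0)"
      by (simp add: Z2_SL2Z_def aff_map_one)
    then show ?thesis
      unfolding simps using aff_ok_one by blast
  qed
  show "\<exists>y\<in>carrier Z2_SL2Z. y \<otimes>\<^bsub>Z2_SL2Z\<^esub> x = \<one>\<^bsub>Z2_SL2Z\<^esub>" if x: "x \<in> carrier Z2_SL2Z" for x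
  proof -
    obtain g where g: "x = aff_map g" "aff_ok g"
      using x unfolding simps by blast
    show ?thesis
    proof
      show "aff_map (aff_inv g) \<in> carrier Z2_SL2Z"
        unfolding simps using aff_ok_inv [OF g(2)] by blast
      show "aff_map (aff_inv g) \<otimes>\<^bsub>Z2_SL2Z\<^esub> x = \<one>\<^bsub>Z2_SL2Z\<^esub>"
        by (simp add: Z2_SL2Z_def g fun_eq_iff aff_map_inv)
    qed
  qed
qed (simp_all add: Z2_SL2Z_def comp_assoc)

lemma bij_carrier_Z2_SL2Z:
  assumes "T \<in> carrier Z2_SL2Z"
  shows "bij T"
proof -
  obtain g where g: "T = aff_map g" "aff_ok g"
    using assms unfolding carrier_Z2_SL2Z by blast
  have "aff_map g (aff_map (aff_inv g) w) = w" for w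
  proof -
    interpret group Z2_SL2Z by (rule group_Z2_SL2Z)
    have c: "aff_map g \<in> carrier Z2_SL2Z" "aff_map (aff_inv g) \<in> carrier Z2_SL2Z"
      unfolding carrier_Z2_SL2Z using g aff_ok_inv by blast+
    have "aff_map (aff_inv g) \<otimes>\<^bsub>Z2_SL2Z\<^esub> aff_map g = \<one>\<^bsub>Z2_SL2Z\<^esub>"
      by (simp add: Z2_SL2Z_def fun_eq_iff aff_map_inv g)
    from inv_comm [OF this c(2) c(1)] show ?thesis
      by (simp add: Z2_SL2Z_def fun_eq_iff)
  qed
  then show ?thesis
    unfolding g(1) by (intro o_bij [of "aff_map (aff_inv g)"]) (auto simp: fun_eq_iff aff_map_inv g)
qed

lemma borel_action_Z2_SL2Z: "borel_action Z2_SL2Z (borel :: (real^2) measure) (\<lambda>T x. T x)"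
  unfolding borel_action_def
proof (intro conjI)
  show count: "countable (carrier Z2_SL2Z)"
    unfolding carrier_Z2_SL2Z by simp
  show "standard_borel (borel :: (real^2) measure)"
    unfolding standard_borel_def
    by (intro exI [of _ euclidean]) (simp add: completely_metrizable_space_euclidean
        second_countable_euclidean sets_borel)
  show "group_action Z2_SL2Z (space (borel :: (real^2) measure)) (\<lambda>T x. T x)"
    unfolding group_action_def
  proof (rule group_hom.intro [OF group_Z2_SL2Z group_BijGroup])
    show "group_hom_axioms Z2_SL2Z (BijGroup (space (borel :: (real^2) measure))) (\<lambda>T x. T x)"
    proof (rule group_hom_axioms.intro, rule homI)
      show B: "(\<lambda>x. T x) \<in> carrier (BijGroup (space (borel :: (real^2) measure)))" if "T \<in> carrier Z2_SL2Z" for T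
        using bij_carrier_Z2_SL2Z [OF that] by (simp add: BijGroup_def Bij_def)
      show "(\<lambda>x. (S \<otimes>\<^bsub>Z2_SL2Z\<^esub> T) x) = (\<lambda>x. S x) \<otimes>\<^bsub>BijGroup (space borel)\<^esub> (\<lambda>x. T x)"
        if "S \<in> carrier Z2_SL2Z" "T \<in> carrier Z2_SL2Z" for S T
        using B [OF that(1)] B [OF that(2)] by (simp add: BijGroup_def Z2_SL2Z_def compose_def o_def restrict_def)
    qed
  qed
  show "(\<lambda>(g, y). g y) \<in> measurable (count_space (carrier Z2_SL2Z) \<Otimes>\<^sub>M borel) (borel :: (real^2) measure)"
  proof (rule measurable_pair_measure_countable1 [OF count])
    fix T assume "T \<in> carrier Z2_SL2Z"
    then obtain A b where T: "T = int_affine_map A b"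
      by (auto simp: Z2_SL2Z_def)
    have "continuous_on UNIV T"
      unfolding T int_affine_map_def [abs_def] by (intro continuous_intros)
    then show "(\<lambda>y. case (T, y) of (g, y) \<Rightarrow> g y) \<in> borel_measurable borel"
      by (simp add: borel_measurable_continuous_onI)
  qed
qed

section \<open>Application to the difference set\<close>

lemma measurable_state_of:
  assumes [measurable]: "\<phi> \<in> borel_measurable M" "\<psi> \<in> borel_measurable M"
  shows "(\<lambda>x. state_of (\<phi> x) (\<psi> x)) \<in> borel_measurable M"
proof -
  have nth: "(\<lambda>x. \<xi> x $ i) \<in> borel_measurable M" if "\<xi> \<in> borel_measurable M" for \<xi> :: "_ \<Rightarrow> real^2" and i
    by (rule measurable_compose [OF that]) (intro borel_measurable_continuous_onI continuous_intros)
  show ?thesis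
    unfolding state_of_def
    by (intro borel_measurable_Pair borel_measurable_diff nth assms)
qed

lemma rel_restrict_borel_equiv_rel:
  assumes E: "borel_equiv_rel X E" and D: "D \<in> sets X"
  shows "borel_equiv_rel (restrict_space X D) (rel_restrict E D)"
proof -
  have DX: "D \<subseteq> space X"
    by (rule sets.sets_into_space [OF D])
  have space: "space (restrict_space X D) = D"
    using DX by (auto simp: space_restrict_space)
  have eq: "equiv (space X) E" and mE: "E \<in> sets (X \<Otimes>\<^sub>M X)"
    using E by (auto simp: borel_equiv_rel_def)
  have "equiv D (rel_restrict E D)"
  proof (rule equivI)
    show "refl_on D (rel_restrict E D)"
      using eq DX by (auto simp: refl_on_def rel_restrict_def equiv_def)
    show "sym (rel_restrict E D)"
      using eq by (auto simp: sym_def rel_restrict_def equiv_def)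
    show "trans (rel_restrict E D)"
      using eq unfolding trans_def rel_restrict_def equiv_def by blast
  qed (auto simp: rel_restrict_def)
  moreover have "rel_restrict E D \<in> sets (restrict_space X D \<Otimes>\<^sub>M restrict_space X D)"
  proof -
    have id: "(\<lambda>x. x) \<in> measurable (restrict_space X D) X"
      by (rule measurable_restrict_space1) simp
    have "(\<lambda>p. (fst p, snd p)) \<in> measurable (restrict_space X D \<Otimes>\<^sub>M restrict_space X D) (X \<Otimes>\<^sub>M X)"
      by (intro measurable_Pair measurable_compose [OF measurable_fst id] measurable_compose [OF measurable_snd id])
    from measurable_sets [OF this mE]
    have "(\<lambda>p. (fst p, snd p)) -` E \<inter> space (restrict_space X D \<Otimes>\<^sub>M restrict_space X D)
      \<in> sets (restrict_space X D \<Otimes>\<^sub>M restrict_space X D)" .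
    moreover have "(\<lambda>p. (fst p, snd p)) -` E \<inter> space (restrict_space X D \<Otimes>\<^sub>M restrict_space X D) = rel_restrict E D"
      by (auto simp: rel_restrict_def space_pair_measure space)
    ultimately show ?thesis
      by simp
  qed
  ultimately show ?thesis
    by (simp add: borel_equiv_rel_def space)
qed

theorem theorem2p1:
  shows "projectively_rigid TYPE('x) Z2_SL2Z (borel :: (real^2) measure) (\<lambda>T x. T x)"
  unfolding projectively_rigid_def
proof (intro conjI borel_action_Z2_SL2Z allI impI)
  fix X :: "'x measure" and E \<rho> and \<phi> \<psi> :: "'x \<Rightarrow> real^2"
  assume X: "standard_borel X" and E: "borel_equiv_rel X E"
    and \<rho>: "\<rho> \<in> measurable (restrict_space (X \<Otimes>\<^sub>M X) E) (count_space (carrier Z2_SL2Z))"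
    and \<phi>: "\<phi> \<in> borel_measurable X" and \<phi>_count: "countable_to_one_on (space X) (space borel) \<phi>"
    and \<phi>_inv: "rho_invariant (space X) E (\<lambda>T x. T x) \<rho> \<phi>"
    and \<psi>: "\<psi> \<in> borel_measurable X"
    and \<psi>_inv: "rho_invariant (space X) E (\<lambda>T x. T x) \<rho> \<psi>"
  define D where "D = difference_set (space X) \<phi> (space X) \<psi>"
  define M where "M = restrict_space X D"
  have D: "D = {x \<in> space X. \<phi> x \<noteq> \<psi> x}"
    by (auto simp: D_def difference_set_def)
  have "{x \<in> space X. \<phi> x = \<psi> x} \<in> sets X"
    by (rule measurable_equality_set [OF \<phi> \<psi>])
  then have "space X - {x \<in> space X. \<phi> x = \<psi> x} \<in> sets X"
    by (rule sets.compl_sets)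
  moreover have "space X - {x \<in> space X. \<phi> x = \<psi> x} = D"
    by (auto simp: D)
  ultimately have DX: "D \<in> sets X"
    by simp
  have space_M: "space M = D"
    by (auto simp: M_def space_restrict_space D)
  obtain c :: "'x \<Rightarrow> nat" where c: "c \<in> measurable X (count_space UNIV)"
    and c_inj: "\<And>x x'. x \<in> space X \<Longrightarrow> x' \<in> space X \<Longrightarrow> \<phi> x = \<phi> x' \<Longrightarrow> c x = c x' \<Longrightarrow> x = x'"
  proof (rule Lusin_Novikov [OF X \<phi>])
    show "countable {x \<in> space X. \<phi> x = y}" for y
      using \<phi>_count by (simp add: countable_to_one_on_def)
  qed blast
  define \<zeta> where "\<zeta> x = state_of (\<phi> x) (\<psi> x)" for x
  have \<zeta>: "\<zeta> \<in> borel_measurable M"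
    unfolding \<zeta>_def [abs_def] M_def
    by (intro measurable_state_of measurable_restrict_space1 \<phi> \<psi>)
  have "hyperfinite M (rel_restrict E D)"
  proof (rule hyperfinite_if_asymptotically_invariant)
    show "borel_equiv_rel M (rel_restrict E D)"
      unfolding M_def by (rule rel_restrict_borel_equiv_rel [OF E DX])
    show "c \<in> measurable M (count_space UNIV)"
      unfolding M_def by (rule measurable_restrict_space1 [OF c])
    show "(\<lambda>x. normal n (\<zeta> x)) \<in> borel_measurable M" for n
      by (rule measurable_compose [OF \<zeta> measurable_normal])
    show "(\<lambda>x. link n (\<zeta> x)) \<in> measurable M (count_space UNIV)" for n
      by (rule measurable_compose [OF \<zeta> measurable_link])
    show "\<exists>m. \<forall>k\<ge>m. normal k (\<zeta> x) = normal k (\<zeta> y)" if "(x, y) \<in> rel_restrict E D" for x y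
    proof -
      have xy: "(x, y) \<in> E" "x \<in> D" "y \<in> D"
        using that by (auto simp: rel_restrict_def)
      then have "(x, y) \<in> space (restrict_space (X \<Otimes>\<^sub>M X) E)"
        by (auto simp: space_restrict_space space_pair_measure D)
      then have "\<rho> (x, y) \<in> carrier Z2_SL2Z"
        using measurable_space [OF \<rho>] by simp
      then obtain g where g: "\<rho> (x, y) = aff_map g" "aff_ok g"
        unfolding carrier_Z2_SL2Z by blast
      \<comment> \<open>The same group element moves both \<phi> and \<psi>, so the pair moves by
        the diagonal action; on \<open>D\<close> its difference vector is nonzero, which guarantees
        good maps at every stage.\<close>
      have "\<phi> x = aff_map g (\<phi> y)" "\<psi> x = aff_map g (\<psi> y)"
        using \<phi>_inv \<psi>_inv xy unfolding rho_invariant_def D g(1) [symmetric] by auto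
      then have "\<zeta> x = act g (\<zeta> y)"
        by (simp add: \<zeta>_def state_of_aff_map)
      moreover have "snd (snd (\<zeta> x)) \<noteq> (0, 0)" "snd (snd (\<zeta> y)) \<noteq> (0, 0)"
        using xy(2,3) by (simp_all only: \<zeta>_def state_of_nonzero) (simp_all add: D)
      ultimately obtain m where "\<forall>k\<ge>m. normal k (\<zeta> y) = normal k (\<zeta> x)"
        using normal_eventually_invariant [OF g(2), of "\<zeta> y"] by auto
      then show ?thesis
        by metis
    qed
    show "link k (\<zeta> x) = link k (\<zeta> y)" if "normal k (\<zeta> x) = normal k (\<zeta> y)"
      "normal (Suc k) (\<zeta> x) = normal (Suc k) (\<zeta> y)" for k x y
      unfolding link_def that ..
    show "normal k (\<zeta> x) = normal k (\<zeta> y)" if "normal (Suc k) (\<zeta> x) = normal (Suc k) (\<zeta> y)"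
      "link k (\<zeta> x) = link k (\<zeta> y)" for k x y
      using link [of k "\<zeta> x"] link [of k "\<zeta> y"] unfolding that by (rule trans [OF sym])
    show "x = y" if "x \<in> space M" "y \<in> space M" "normal 0 (\<zeta> x) = normal 0 (\<zeta> y)" "c x = c y" for x y
    proof (rule c_inj)
      show "x \<in> space X" "y \<in> space X"
        using that by (simp_all add: space_M D)
      show "\<phi> x = \<phi> y"
        using that(3) by (simp add: \<zeta>_def state_of_eq_iff)
    qed (rule that)
  qed
  then show "hyperfinite (restrict_space X (difference_set (space X) \<phi> (space X) \<psi>))
      (rel_restrict E (difference_set (space X) \<phi> (space X) \<psi>))"
    by (simp only: M_def D_def)
qed

end
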